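(* Let $S=(\mathcal S,\mathcal A,\mathcal R)$ be a functional PTS specification, let $\Gamma$ be a context of $\lambda S$ and let $A$ be a $\Gamma$-type of $\lambda S$. If there is a term $N$ such that $\|\Gamma\| \vdash_{\lambda\Pi/S} N : \|A\|_{\Gamma}$, then there is a term $M$ such that $\Gamma \vdash_{\lambda S} M : A$.
   Context: Pure type systems. A PTS specification is $S=(\mathcal S,\mathcal A,\mathcal R)$ with $\mathcal S$ a set of sorts, $\mathcal A\subseteq\mathcal S\times\mathcal S$ a set of axioms written $(s_1:s_2)$, and $\mathcal R\subseteq \mathcal S\times\mathcal S\times\mathcal S$ a set of rules; $(s_1,s_2)$ abbreviates $(s_1,s_2,s_2)$. $S$ is functional if $(s_1:s_2),(s_1:s_2')\in\mathcal A$ imply $s_2=s_2'$ and $(s_1,s_2,s_3),(s_1,s_2,s_3')\in\mathcal R$ imply $s_3=s_3'$. Terms are $T::= s\mid x\mid T\,T\mid \lambda x:T.\,T\mid \Pi x:T.\,T$ ($s$ a sort, $x$ a variable); contexts are lists $x_1:A_1,\dots,x_n:A_n$; $A\to B$ denotes $\Pi x:A.B$ with $x$ not free in $B$. The typing rules of $\lambda S$ (judgments $\mathrm{WF}(\Gamma)$ and $\Gamma\vdash M:A$) are: $\mathrm{WF}(\cdot)$; if $\Gamma\vdash A:s$ and $x\notin\Gamma$ then $\mathrm{WF}(\Gamma,x:A)$; if $\mathrm{WF}(\Gamma)$ and $(x:A)\in\Gamma$ then $\Gamma\vdash x:A$; if $\mathrm{WF}(\Gamma)$ and $(s_1:s_2)\in\mathcal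 A$ then $\Gamma\vdash s_1:s_2$; if $\Gamma\vdash A:s_1$, $\Gamma,x:A\vdash B:s_2$ and $(s_1,s_2,s_3)\in\mathcal R$ then $\Gamma\vdash \Pi x:A.B:s_3$; if $\Gamma,x:A\vdash M:B$ and $\Gamma\vdash\Pi x:A.B:s$ then $\Gamma\vdash\lambda x:A.M:\Pi x:A.B$; if $\Gamma\vdash M:\Pi x:A.B$ and $\Gamma\vdash N:A$ then $\Gamma\vdash M\,N:B[N/x]$; if $\Gamma\vdash M:A$, $\Gamma\vdash B:s$ and $A\equiv_\beta B$ then $\Gamma\vdash M:B$. A $\Gamma$-term is an $M$ with $\mathrm{WF}(\Gamma)$ and $\Gamma\vdash M:A$ for some $A$; a $\Gamma$-type is an $A$ with $\mathrm{WF}(\Gamma)$ and either $\Gamma\vdash A:s$ or $A=s$ for some sort $s$. The $\lambda\Pi$ calculus modulo rewriting. $\lambda\Pi$ is the PTS with sorts $\mathsf{Type},\mathsf{Kind}$, axiom $\mathsf{Type}:\mathsf{Kind}$ and rules $(\mathsf{Type},\mathsf{Type}),(\mathsf{Type},\mathsf{Kind})$. Given a well-formed $\lambda\Pi$ context $\Sigma$ and a set $R$ of rewrite rules $[\Delta]\,M\leadsto N$, $\longrightarrow_R$ is the contextual closure of $\sigma(M)\longrightarrow_R\sigma(N)$ for substitutions $\sigma$ of the variables of $\Delta$, $\longrightarrow_{\beta R}=\longrightarrow_\beta\cup\longrightarrow_R$, and $\equiv_{\beta R}$ is the generated congruence. $\lambda\Pi/(\Sigma,R)$ has the typing rules of $\lambda\Pi$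 except that declarations require $x\notin\Sigma,\Gamma$, the variable rule allows $(x:A)\in\Sigma,\Gamma$, and conversion uses $\equiv_{\beta R}$ instead of $\equiv_\beta$. The system $\lambda\Pi/S$ is $\lambda\Pi/(\Sigma_S,R_S)$ where $\Sigma_S$ declares: $u_s:\mathsf{Type}$ and $\varepsilon_s:u_s\to\mathsf{Type}$ for each $s\in\mathcal S$; $\dot s_1:u_{s_2}$ for each $(s_1:s_2)\in\mathcal A$; $\dot\pi_{s_1s_2s_3}:\Pi\alpha:u_{s_1}.\,(\varepsilon_{s_1}\alpha\to u_{s_2})\to u_{s_3}$ for each $(s_1,s_2,s_3)\in\mathcal R$; and $R_S$ contains $\varepsilon_{s_2}\,\dot s_1\leadsto u_{s_1}$ for $(s_1:s_2)\in\mathcal A$ and $[A:u_{s_1},B:\varepsilon_{s_1}A\to u_{s_2}]\ \varepsilon_{s_3}(\dot\pi_{s_1s_2s_3}\,A\,B)\leadsto \Pi x:\varepsilon_{s_1}A.\,\varepsilon_{s_2}(B\,x)$ for $(s_1,s_2,s_3)\in\mathcal R$. Translation. For $\Gamma$-terms and $\Gamma$-types of $\lambda S$: $|s|_\Gamma=\dot s$, $|x|_\Gamma=x$, $|M\,N|_\Gamma=|M|_\Gamma\,|N|_\Gamma$, $|\lambda x:A.M|_\Gamma=\lambda x:\|A\|_\Gamma.\,|M|_{\Gamma,x:A}$, $|\Pi x:A.B|_\Gamma=\dot\pi_{s_1s_2s_3}\,|A|_\Gamma\,(\lambda x:\|A\|_\Gamma.\,|B|_{\Gamma,x:A})$ where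 $\Gamma\vdash A:s_1$, $\Gamma,x:A\vdash B:s_2$, $(s_1,s_2,s_3)\in\mathcal R$; $\|s\|_\Gamma=u_s$, $\|\Pi x:A.B\|_\Gamma=\Pi x:\|A\|_\Gamma.\,\|B\|_{\Gamma,x:A}$, and otherwise $\|A\|_\Gamma=\varepsilon_s\,|A|_\Gamma$ where $\Gamma\vdash A:s$ (well defined up to $\equiv_{\beta R}$). Contexts: $\|\cdot\|=\cdot$, $\|\Gamma,x:A\|=\|\Gamma\|,x:\|A\|_\Gamma$. *)

theory Defs
  imports Main
begin

datatype 's pterm =
    PSort 's
  | PVar nat
  | PApp "'s pterm" "'s pterm"
  | PLam "'s pterm" "'s pterm"   (* PLam A M  =  lambda x:A. M, x bound as index 0 in M *)
  | PPi "'s pterm" "'s pterm"    (* PPi A B   =  Pi x:A. B,     x bound as index 0 in B *)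

fun plift :: "nat \<Rightarrow> 's pterm \<Rightarrow> 's pterm" where
  "plift k (PSort s) = PSort s"
| "plift k (PVar i) = (if i < k then PVar i else PVar (Suc i))"
| "plift k (PApp M N) = PApp (plift k M) (plift k N)"
| "plift k (PLam A M) = PLam (plift k A) (plift (Suc k) M)"
| "plift k (PPi A B) = PPi (plift k A) (plift (Suc k) B)"

fun psubst :: "'s pterm \<Rightarrow> nat \<Rightarrow> 's pterm \<Rightarrow> 's pterm" where
  "psubst (PSort s) k N = PSort s"
| "psubst (PVar i) k N = (if k < i then PVar (i - 1) else if i = k then N else PVar i)"
| "psubst (PApp M1 M2) k N = PApp (psubst M1 k N) (psubst M2 k N)"
| "psubst (PLam A M) k N = PLam (psubst A k N) (psubst M (Suc k) (plift 0 N))"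
| "psubst (PPi A B) k N = PPi (psubst A k N) (psubst B (Suc k) (plift 0 N))"

inductive pbeta :: "'s pterm \<Rightarrow> 's pterm \<Rightarrow> bool" where
  beta: "pbeta (PApp (PLam A M) N) (psubst M 0 N)"
| appL: "pbeta M M' \<Longrightarrow> pbeta (PApp M N) (PApp M' N)"
| appR: "pbeta N N' \<Longrightarrow> pbeta (PApp M N) (PApp M N')"
| lamL: "pbeta A A' \<Longrightarrow> pbeta (PLam A M) (PLam A' M)"
| lamR: "pbeta M M' \<Longrightarrow> pbeta (PLam A M) (PLam A M')"
| piL: "pbeta A A' \<Longrightarrow> pbeta (PPi A B) (PPi A' B)"
| piR: "pbeta B B' \<Longrightarrow> pbeta (PPi A B) (PPi A B')"

abbreviation pconv :: "'s pterm \<Rightarrow> 's pterm \<Rightarrow> bool" where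
  "pconv \<equiv> equivclp pbeta"

definition pts_spec :: "'s set \<Rightarrow> ('s \<times> 's) set \<Rightarrow> ('s \<times> 's \<times> 's) set \<Rightarrow> bool" where
  "pts_spec Srt Ax Rl \<longleftrightarrow> Ax \<subseteq> Srt \<times> Srt \<and> Rl \<subseteq> Srt \<times> Srt \<times> Srt"

definition functional_spec :: "('s \<times> 's) set \<Rightarrow> ('s \<times> 's \<times> 's) set \<Rightarrow> bool" where
  "functional_spec Ax Rl \<longleftrightarrow>
     (\<forall>s1 s2 s2'. (s1, s2) \<in> Ax \<longrightarrow> (s1, s2') \<in> Ax \<longrightarrow> s2 = s2') \<and>
     (\<forall>s1 s2 s3 s3'. (s1, s2, s3) \<in> Rl \<longrightarrow> (s1, s2, s3') \<in> Rl \<longrightarrow> s3 = s3')"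

(* Contexts are lists, the most recent declaration first (index 0). *)
inductive pts_wf :: "('s \<times> 's) set \<Rightarrow> ('s \<times> 's \<times> 's) set \<Rightarrow> 's pterm list \<Rightarrow> bool"
  and pts_typ :: "('s \<times> 's) set \<Rightarrow> ('s \<times> 's \<times> 's) set \<Rightarrow> 's pterm list \<Rightarrow> 's pterm \<Rightarrow> 's pterm \<Rightarrow> bool"
  for Ax Rl where
  wf_nil: "pts_wf Ax Rl []"
| wf_cons: "pts_typ Ax Rl \<Gamma> A (PSort s) \<Longrightarrow> pts_wf Ax Rl (A # \<Gamma>)"
| t_var: "pts_wf Ax Rl \<Gamma> \<Longrightarrow> i < length \<Gamma> \<Longrightarrow> pts_typ Ax Rl \<Gamma> (PVar i) ((plift 0 ^^ Suc i) (\<Gamma> ! i))"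
| t_sort: "pts_wf Ax Rl \<Gamma> \<Longrightarrow> (s1, s2) \<in> Ax \<Longrightarrow> pts_typ Ax Rl \<Gamma> (PSort s1) (PSort s2)"
| t_pi: "pts_typ Ax Rl \<Gamma> A (PSort s1) \<Longrightarrow> pts_typ Ax Rl (A # \<Gamma>) B (PSort s2) \<Longrightarrow>
         (s1, s2, s3) \<in> Rl \<Longrightarrow> pts_typ Ax Rl \<Gamma> (PPi A B) (PSort s3)"
| t_lam: "pts_typ Ax Rl (A # \<Gamma>) M B \<Longrightarrow> pts_typ Ax Rl \<Gamma> (PPi A B) (PSort s) \<Longrightarrow>
          pts_typ Ax Rl \<Gamma> (PLam A M) (PPi A B)"
| t_app: "pts_typ Ax Rl \<Gamma> M (PPi A B) \<Longrightarrow> pts_typ Ax Rl \<Gamma> N A \<Longrightarrow>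
          pts_typ Ax Rl \<Gamma> (PApp M N) (psubst B 0 N)"
| t_conv: "pts_typ Ax Rl \<Gamma> M A \<Longrightarrow> pts_typ Ax Rl \<Gamma> B (PSort s) \<Longrightarrow> pconv A B \<Longrightarrow>
           pts_typ Ax Rl \<Gamma> M B"

definition pts_is_type :: "'s set \<Rightarrow> ('s \<times> 's) set \<Rightarrow> ('s \<times> 's \<times> 's) set \<Rightarrow> 's pterm list \<Rightarrow> 's pterm \<Rightarrow> bool" where
  "pts_is_type Srt Ax Rl \<Gamma> A \<longleftrightarrow> pts_wf Ax Rl \<Gamma> \<and>
     ((\<exists>s. pts_typ Ax Rl \<Gamma> A (PSort s)) \<or> (\<exists>s\<in>Srt. A = PSort s))"

datatype lpsort = Type | Kind

datatype 'c dterm =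
    DSort lpsort
  | DVar nat
  | DConst 'c
  | DApp "'c dterm" "'c dterm"
  | DLam "'c dterm" "'c dterm"
  | DPi "'c dterm" "'c dterm"

fun dlift :: "nat \<Rightarrow> 'c dterm \<Rightarrow> 'c dterm" where
  "dlift k (DSort s) = DSort s"
| "dlift k (DVar i) = (if i < k then DVar i else DVar (Suc i))"
| "dlift k (DConst c) = DConst c"
| "dlift k (DApp M N) = DApp (dlift k M) (dlift k N)"
| "dlift k (DLam A M) = DLam (dlift k A) (dlift (Suc k) M)"
| "dlift k (DPi A B) = DPi (dlift k A) (dlift (Suc k) B)"

fun dsubst :: "'c dterm \<Rightarrow> nat \<Rightarrow> 'c dterm \<Rightarrow> 'c dterm" where
  "dsubst (DSort s) k N = DSort s"
| "dsubst (DVar i) k N = (if k < i then DVar (i - 1) else if i = k then N else DVar i)"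
| "dsubst (DConst c) k N = DConst c"
| "dsubst (DApp M1 M2) k N = DApp (dsubst M1 k N) (dsubst M2 k N)"
| "dsubst (DLam A M) k N = DLam (dsubst A k N) (dsubst M (Suc k) (dlift 0 N))"
| "dsubst (DPi A B) k N = DPi (dsubst A k N) (dsubst B (Suc k) (dlift 0 N))"

(* One step of beta R reduction: R is the set of instances sigma(M) ~> sigma(N) of the
   rewrite rules; the step relation is the contextual closure of beta and R. *)
inductive dstep :: "('c dterm \<Rightarrow> 'c dterm \<Rightarrow> bool) \<Rightarrow> 'c dterm \<Rightarrow> 'c dterm \<Rightarrow> bool"
  for R where
  beta: "dstep R (DApp (DLam A M) N) (dsubst M 0 N)"
| rew: "R M N \<Longrightarrow> dstep R M N"
| appL: "dstep R M M' \<Longrightarrow> dstep R (DApp M N) (DApp M' N)"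
| appR: "dstep R N N' \<Longrightarrow> dstep R (DApp M N) (DApp M N')"
| lamL: "dstep R A A' \<Longrightarrow> dstep R (DLam A M) (DLam A' M)"
| lamR: "dstep R M M' \<Longrightarrow> dstep R (DLam A M) (DLam A M')"
| piL: "dstep R A A' \<Longrightarrow> dstep R (DPi A B) (DPi A' B)"
| piR: "dstep R B B' \<Longrightarrow> dstep R (DPi A B) (DPi A B')"

abbreviation dconv :: "('c dterm \<Rightarrow> 'c dterm \<Rightarrow> bool) \<Rightarrow> 'c dterm \<Rightarrow> 'c dterm \<Rightarrow> bool" where
  "dconv R \<equiv> equivclp (dstep R)"

inductive lp_wf :: "('c \<Rightarrow> 'c dterm \<Rightarrow> bool) \<Rightarrow> ('c dterm \<Rightarrow> 'c dterm \<Rightarrow> bool) \<Rightarrow> 'c dterm list \<Rightarrow> bool"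
  and lp_typ :: "('c \<Rightarrow> 'c dterm \<Rightarrow> bool) \<Rightarrow> ('c dterm \<Rightarrow> 'c dterm \<Rightarrow> bool) \<Rightarrow> 'c dterm list \<Rightarrow> 'c dterm \<Rightarrow> 'c dterm \<Rightarrow> bool"
  for sig R where
  wf_nil: "lp_wf sig R []"
| wf_cons: "lp_typ sig R \<Gamma> A (DSort s) \<Longrightarrow> lp_wf sig R (A # \<Gamma>)"
| t_var: "lp_wf sig R \<Gamma> \<Longrightarrow> i < length \<Gamma> \<Longrightarrow> lp_typ sig R \<Gamma> (DVar i) ((dlift 0 ^^ Suc i) (\<Gamma> ! i))"
| t_const: "lp_wf sig R \<Gamma> \<Longrightarrow> sig c T \<Longrightarrow> lp_typ sig R \<Gamma> (DConst c) T"
| t_sort: "lp_wf sig R \<Gamma> \<Longrightarrow> lp_typ sig R \<Gamma> (DSort Type) (DSort Kind)"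
| t_pi: "lp_typ sig R \<Gamma> A (DSort Type) \<Longrightarrow> lp_typ sig R (A # \<Gamma>) B (DSort s) \<Longrightarrow>
         lp_typ sig R \<Gamma> (DPi A B) (DSort s)"
| t_lam: "lp_typ sig R (A # \<Gamma>) M B \<Longrightarrow> lp_typ sig R \<Gamma> (DPi A B) (DSort s) \<Longrightarrow>
          lp_typ sig R \<Gamma> (DLam A M) (DPi A B)"
| t_app: "lp_typ sig R \<Gamma> M (DPi A B) \<Longrightarrow> lp_typ sig R \<Gamma> N A \<Longrightarrow>
          lp_typ sig R \<Gamma> (DApp M N) (dsubst B 0 N)"
| t_conv: "lp_typ sig R \<Gamma> M A \<Longrightarrow> lp_typ sig R \<Gamma> B (DSort s) \<Longrightarrow> dconv R A B \<Longrightarrow>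
           lp_typ sig R \<Gamma> M B"

datatype 's sconst = U 's | Eps 's | Dot 's | PiC 's 's 's

inductive sigS :: "'s set \<Rightarrow> ('s \<times> 's) set \<Rightarrow> ('s \<times> 's \<times> 's) set \<Rightarrow> 's sconst \<Rightarrow> 's sconst dterm \<Rightarrow> bool"
  for Srt Ax Rl where
  sig_U: "s \<in> Srt \<Longrightarrow> sigS Srt Ax Rl (U s) (DSort Type)"
| sig_Eps: "s \<in> Srt \<Longrightarrow> sigS Srt Ax Rl (Eps s) (DPi (DConst (U s)) (DSort Type))"
| sig_Dot: "(s1, s2) \<in> Ax \<Longrightarrow> sigS Srt Ax Rl (Dot s1) (DConst (U s2))"
| sig_Pi: "(s1, s2, s3) \<in> Rl \<Longrightarrow> sigS Srt Ax Rl (PiC s1 s2 s3)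
     (DPi (DConst (U s1))
        (DPi (DPi (DApp (DConst (Eps s1)) (DVar 0)) (DConst (U s2))) (DConst (U s3))))"

inductive rwS :: "('s \<times> 's) set \<Rightarrow> ('s \<times> 's \<times> 's) set \<Rightarrow> 's sconst dterm \<Rightarrow> 's sconst dterm \<Rightarrow> bool"
  for Ax Rl where
  rw_sort: "(s1, s2) \<in> Ax \<Longrightarrow> rwS Ax Rl (DApp (DConst (Eps s2)) (DConst (Dot s1))) (DConst (U s1))"
| rw_pi: "(s1, s2, s3) \<in> Rl \<Longrightarrow>
    rwS Ax Rl (DApp (DConst (Eps s3)) (DApp (DApp (DConst (PiC s1 s2 s3)) A) B))
              (DPi (DApp (DConst (Eps s1)) A) (DApp (DConst (Eps s2)) (DApp (dlift 0 B) (DVar 0))))"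

inductive trm_tr :: "('s \<times> 's) set \<Rightarrow> ('s \<times> 's \<times> 's) set \<Rightarrow> 's pterm list \<Rightarrow> 's pterm \<Rightarrow> 's sconst dterm \<Rightarrow> bool"
  and typ_tr :: "('s \<times> 's) set \<Rightarrow> ('s \<times> 's \<times> 's) set \<Rightarrow> 's pterm list \<Rightarrow> 's pterm \<Rightarrow> 's sconst dterm \<Rightarrow> bool"
  for Ax Rl where
  tr_sort: "trm_tr Ax Rl \<Gamma> (PSort s) (DConst (Dot s))"
| tr_var: "trm_tr Ax Rl \<Gamma> (PVar i) (DVar i)"
| tr_app: "trm_tr Ax Rl \<Gamma> M M' \<Longrightarrow> trm_tr Ax Rl \<Gamma> N N' \<Longrightarrow> trm_tr Ax Rl \<Gamma> (PApp M N) (DApp M' N')"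
| tr_lam: "typ_tr Ax Rl \<Gamma> A A' \<Longrightarrow> trm_tr Ax Rl (A # \<Gamma>) M M' \<Longrightarrow>
           trm_tr Ax Rl \<Gamma> (PLam A M) (DLam A' M')"
| tr_pi: "pts_typ Ax Rl \<Gamma> A (PSort s1) \<Longrightarrow> pts_typ Ax Rl (A # \<Gamma>) B (PSort s2) \<Longrightarrow>
          (s1, s2, s3) \<in> Rl \<Longrightarrow> trm_tr Ax Rl \<Gamma> A A1 \<Longrightarrow> typ_tr Ax Rl \<Gamma> A A2 \<Longrightarrow>
          trm_tr Ax Rl (A # \<Gamma>) B B' \<Longrightarrow>
          trm_tr Ax Rl \<Gamma> (PPi A B) (DApp (DApp (DConst (PiC s1 s2 s3)) A1) (DLam A2 B'))"
| ty_sort: "typ_tr Ax Rl \<Gamma> (PSort s) (DConst (U s))"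
| ty_pi: "typ_tr Ax Rl \<Gamma> A A' \<Longrightarrow> typ_tr Ax Rl (A # \<Gamma>) B B' \<Longrightarrow>
          typ_tr Ax Rl \<Gamma> (PPi A B) (DPi A' B')"
| ty_other: "(\<forall>s'. A \<noteq> PSort s') \<Longrightarrow> (\<forall>X Y. A \<noteq> PPi X Y) \<Longrightarrow> pts_typ Ax Rl \<Gamma> A (PSort s) \<Longrightarrow>
             trm_tr Ax Rl \<Gamma> A A' \<Longrightarrow> typ_tr Ax Rl \<Gamma> A (DApp (DConst (Eps s)) A')"

inductive ctx_tr :: "('s \<times> 's) set \<Rightarrow> ('s \<times> 's \<times> 's) set \<Rightarrow> 's pterm list \<Rightarrow> 's sconst dterm list \<Rightarrow> bool"
  for Ax Rl where
  ctx_nil: "ctx_tr Ax Rl [] []"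
| ctx_cons: "ctx_tr Ax Rl \<Gamma> \<Gamma>' \<Longrightarrow> typ_tr Ax Rl \<Gamma> A A' \<Longrightarrow> ctx_tr Ax Rl (A # \<Gamma>) (A' # \<Gamma>')"

end

theory Submission
  imports Defs "HOL-Library.Confluence"
begin

text \<open>
  Terms of the framework are mapped back to PTS terms without regard to types, reading \<open>\<epsilon>\<^sub>s\<close> as the
  identity function and the constants for products as functions returning a product. This turns
  conversion in the framework into \<open>\<beta>\<close>-conversion, but the image of a typable term need not be typable,
  since the framework may abstract where the source system has no product rule. A Kripke logical
  relation repairs this. Every type family of the framework has a simple skeleton, which is invariant
  under substitution and, by confluence and functionality, under conversion. A universe,
  or a type whose skeleton is a sort of the source system, is interpreted by the terms convertible to a
  term that has this type in the source system; every other product is interpreted as a function space. Typable terms of the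
  framework are reducible, and for translated types reducibility yields the required inhabitant.
\<close>

text \<open>Already over the simply typed lambda calculus the framework may use a polymorphic
  identity over a universe \<open>U s\<close>, whose image would need a product over a sort.
  Function spaces alone would not suffice: an element \<open>M\<close> can be evaluated at a fresh
  variable to obtain a typable body, but without eta \<open>M\<close> itself need not be convertible
  to an abstraction over that body. Hence products that have a source rule are interpreted directly
  by typability. The relation is closed under untyped conversion of term and type, so untypable
  redexes in the image do no harm and no normalisation is involved: the inhabitant found is a term
  convertible to the image of \<open>N\<close>. The need for fresh variables explains why the worlds
  are contexts related by renamings. Dependent types usually force such a relation to be defined
  together with its types; here the framework never binds a type variable, so a skeleton can be read
  off the syntax and the relation is a primitive recursion on it.\<close>

section \<open>Sequences and renamings\<close>

definition scons :: "'a \<Rightarrow> (nat \<Rightarrow> 'a) \<Rightarrow> nat \<Rightarrow> 'a" (infixr "\<cdot>" 65) where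
  "N \<cdot> \<sigma> = case_nat N \<sigma>"

lemma scons_simps [simp]: "(N \<cdot> \<sigma>) 0 = N" "(N \<cdot> \<sigma>) (Suc i) = \<sigma> i"
  by (simp_all add: scons_def)

lemma comp_scons: "f \<circ> (N \<cdot> \<sigma>) = f N \<cdot> (f \<circ> \<sigma>)"
  by (rule ext) (simp add: scons_def split: nat.split)

lemma scons_comp_Suc [simp]: "(N \<cdot> \<sigma>) \<circ> Suc = \<sigma>"
  by (rule ext) simp

lemma scons_eta: "\<sigma> = \<sigma> 0 \<cdot> (\<sigma> \<circ> Suc)"
  by (rule ext) (simp add: scons_def split: nat.split)

definition ren_up :: "(nat \<Rightarrow> nat) \<Rightarrow> nat \<Rightarrow> nat" where
  "ren_up \<xi> = 0 \<cdot> (Suc \<circ> \<xi>)"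

lemma ren_up_simps [simp]: "ren_up \<xi> 0 = 0" "ren_up \<xi> (Suc i) = Suc (\<xi> i)"
  by (simp_all add: ren_up_def)

lemma ren_up_comp: "ren_up \<xi> \<circ> ren_up \<zeta> = ren_up (\<xi> \<circ> \<zeta>)"
  by (rule ext, rename_tac i, case_tac i) simp_all

lemma ren_up_comp_Suc: "ren_up \<xi> \<circ> Suc = Suc \<circ> \<xi>"
  by (rule ext) simp

lemma ren_up_shift: "ren_up (\<lambda>i. if i < k then i else Suc i) = (\<lambda>i. if i < Suc k then i else Suc i)"
  by (rule ext, rename_tac i, case_tac i) simp_all

subsection \<open>Simultaneous substitution in PTS terms\<close>

primrec pren :: "(nat \<Rightarrow> nat) \<Rightarrow> 's pterm \<Rightarrow> 's pterm" where
  "pren \<xi> (PSort s) = PSort s"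
| "pren \<xi> (PVar i) = PVar (\<xi> i)"
| "pren \<xi> (PApp M N) = PApp (pren \<xi> M) (pren \<xi> N)"
| "pren \<xi> (PLam A M) = PLam (pren \<xi> A) (pren (ren_up \<xi>) M)"
| "pren \<xi> (PPi A B) = PPi (pren \<xi> A) (pren (ren_up \<xi>) B)"

definition pup :: "(nat \<Rightarrow> 's pterm) \<Rightarrow> nat \<Rightarrow> 's pterm" where
  "pup \<sigma> = PVar 0 \<cdot> (pren Suc \<circ> \<sigma>)"

lemma pup_simps [simp]: "pup \<sigma> 0 = PVar 0" "pup \<sigma> (Suc i) = pren Suc (\<sigma> i)"
  by (simp_all add: pup_def)

primrec pinst :: "(nat \<Rightarrow> 's pterm) \<Rightarrow> 's pterm \<Rightarrow> 's pterm" where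
  "pinst \<sigma> (PSort s) = PSort s"
| "pinst \<sigma> (PVar i) = \<sigma> i"
| "pinst \<sigma> (PApp M N) = PApp (pinst \<sigma> M) (pinst \<sigma> N)"
| "pinst \<sigma> (PLam A M) = PLam (pinst \<sigma> A) (pinst (pup \<sigma>) M)"
| "pinst \<sigma> (PPi A B) = PPi (pinst \<sigma> A) (pinst (pup \<sigma>) B)"

lemma pren_pren: "pren \<xi> (pren \<zeta> M) = pren (\<xi> \<circ> \<zeta>) M"
  by (induction M arbitrary: \<xi> \<zeta>) (simp_all add: ren_up_comp)

lemma pup_comp_ren_up: "pup \<sigma> \<circ> ren_up \<xi> = pup (\<sigma> \<circ> \<xi>)"
  by (rule ext, rename_tac i, case_tac i) simp_all

lemma pinst_pren: "pinst \<sigma> (pren \<xi> M) = pinst (\<sigma> \<circ> \<xi>) M"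
  by (induction M arbitrary: \<xi> \<sigma>) (simp_all add: pup_comp_ren_up)

lemma pren_comp_pup: "pren (ren_up \<xi>) \<circ> pup \<sigma> = pup (pren \<xi> \<circ> \<sigma>)"
  by (rule ext, rename_tac i, case_tac i) (simp_all add: pren_pren ren_up_comp_Suc)

lemma pren_pinst: "pren \<xi> (pinst \<sigma> M) = pinst (pren \<xi> \<circ> \<sigma>) M"
  by (induction M arbitrary: \<xi> \<sigma>) (simp_all add: pren_comp_pup)

lemma pinst_comp_pup: "pinst (pup \<tau>) \<circ> pup \<sigma> = pup (pinst \<tau> \<circ> \<sigma>)"
proof (rule ext)
  fix i
  have "pup \<tau> \<circ> Suc = pren Suc \<circ> \<tau>" by (rule ext) simp
  then show "(pinst (pup \<tau>) \<circ> pup \<sigma>) i = pup (pinst \<tau> \<circ> \<sigma>) i"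
    by (cases i) (simp_all add: pren_pinst pinst_pren)
qed

lemma pinst_pinst: "pinst \<tau> (pinst \<sigma> M) = pinst (pinst \<tau> \<circ> \<sigma>) M"
  by (induction M arbitrary: \<tau> \<sigma>) (simp_all add: pinst_comp_pup)

lemma pup_PVar [simp]: "pup PVar = PVar"
  by (rule ext, rename_tac i, case_tac i) simp_all

lemma pinst_PVar [simp]: "pinst PVar M = M"
  by (induction M) simp_all

lemma pren_eq_pinst: "pren \<xi> M = pinst (PVar \<circ> \<xi>) M"
proof -
  have "pren \<xi> M = pren \<xi> (pinst PVar M)" by simp
  also have "\<dots> = pinst (PVar \<circ> \<xi>) M"
    by (simp only: pren_pinst) (rule arg_cong[where f = "\<lambda>\<sigma>. pinst \<sigma> M"], rule ext, simp)
  finally show ?thesis .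
qed

lemma pren_id [simp]: "pren id M = M"
  by (simp add: pren_eq_pinst)

lemma plift_eq_pren: "plift k M = pren (\<lambda>i. if i < k then i else Suc i) M"
  by (induction M arbitrary: k) (auto simp: ren_up_shift)

lemma plift_0: "plift 0 M = pren Suc M"
  by (simp add: plift_eq_pren)

lemma psubst_eq_pinst:
  "psubst M k N = pinst (\<lambda>i. if k < i then PVar (i - 1) else if i = k then N else PVar i) M"
proof (induction M arbitrary: k N)
  have up: "pup (\<lambda>i. if k < i then PVar (i - 1) else if i = k then N else PVar i) =
    (\<lambda>i. if Suc k < i then PVar (i - 1) else if i = Suc k then plift 0 N else PVar i)" for k N
    by (rule ext, rename_tac i, case_tac i) (auto simp: plift_0)
  {
    case (PLam A M)
    then show ?case by (simp add: up)
  next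
    case (PPi A M)
    then show ?case by (simp add: up)
  }
qed auto

lemma psubst_0: "psubst M 0 N = pinst (N \<cdot> PVar) M"
  unfolding psubst_eq_pinst
  by (rule arg_cong[where f = "\<lambda>\<sigma>. pinst \<sigma> M"], rule ext, rename_tac i, case_tac i) simp_all

lemma pinst_scons_pup: "pinst (N \<cdot> \<tau>) (pinst (pup \<sigma>) M) = pinst (N \<cdot> (pinst \<tau> \<circ> \<sigma>)) M"
  unfolding pinst_pinst
  by (rule arg_cong[where f = "\<lambda>\<sigma>. pinst \<sigma> M"], rule ext, rename_tac i, case_tac i)
    (simp_all add: pinst_pren)

lemma psubst_pinst_pup: "psubst (pinst (pup \<sigma>) M) 0 N = pinst (N \<cdot> \<sigma>) M"
proof -
  have "pinst PVar \<circ> \<sigma> = \<sigma>" by (rule ext) simp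
  then show ?thesis by (simp add: psubst_0 pinst_scons_pup)
qed

lemma pinst_psubst: "pinst \<sigma> (psubst M 0 N) = psubst (pinst (pup \<sigma>) M) 0 (pinst \<sigma> N)"
proof -
  have "pinst \<sigma> \<circ> PVar = \<sigma>" by (rule ext) simp
  then show ?thesis by (simp add: psubst_pinst_pup) (simp add: psubst_0 pinst_pinst comp_scons)
qed

lemma PVar_comp_ren_up: "PVar \<circ> ren_up \<xi> = pup (PVar \<circ> \<xi>)"
  by (rule ext, rename_tac i, case_tac i) simp_all

lemma pren_psubst: "pren \<xi> (psubst M 0 N) = psubst (pren (ren_up \<xi>) M) 0 (pren \<xi> N)"
  by (simp add: pren_eq_pinst pinst_psubst PVar_comp_ren_up)

subsection \<open>Simultaneous substitution in terms of the framework\<close>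

primrec dren :: "(nat \<Rightarrow> nat) \<Rightarrow> 'c dterm \<Rightarrow> 'c dterm" where
  "dren \<xi> (DSort s) = DSort s"
| "dren \<xi> (DVar i) = DVar (\<xi> i)"
| "dren \<xi> (DConst c) = DConst c"
| "dren \<xi> (DApp M N) = DApp (dren \<xi> M) (dren \<xi> N)"
| "dren \<xi> (DLam A M) = DLam (dren \<xi> A) (dren (ren_up \<xi>) M)"
| "dren \<xi> (DPi A B) = DPi (dren \<xi> A) (dren (ren_up \<xi>) B)"

definition dup :: "(nat \<Rightarrow> 'c dterm) \<Rightarrow> nat \<Rightarrow> 'c dterm" where
  "dup \<sigma> = DVar 0 \<cdot> (dren Suc \<circ> \<sigma>)"

lemma dup_simps [simp]: "dup \<sigma> 0 = DVar 0" "dup \<sigma> (Suc i) = dren Suc (\<sigma> i)"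
  by (simp_all add: dup_def)

primrec dinst :: "(nat \<Rightarrow> 'c dterm) \<Rightarrow> 'c dterm \<Rightarrow> 'c dterm" where
  "dinst \<sigma> (DSort s) = DSort s"
| "dinst \<sigma> (DVar i) = \<sigma> i"
| "dinst \<sigma> (DConst c) = DConst c"
| "dinst \<sigma> (DApp M N) = DApp (dinst \<sigma> M) (dinst \<sigma> N)"
| "dinst \<sigma> (DLam A M) = DLam (dinst \<sigma> A) (dinst (dup \<sigma>) M)"
| "dinst \<sigma> (DPi A B) = DPi (dinst \<sigma> A) (dinst (dup \<sigma>) B)"

lemma dren_dren: "dren \<xi> (dren \<zeta> M) = dren (\<xi> \<circ> \<zeta>) M"
  by (induction M arbitrary: \<xi> \<zeta>) (simp_all add: ren_up_comp)

lemma dup_comp_ren_up: "dup \<sigma> \<circ> ren_up \<xi> = dup (\<sigma> \<circ> \<xi>)"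
  by (rule ext, rename_tac i, case_tac i) simp_all

lemma dinst_dren: "dinst \<sigma> (dren \<xi> M) = dinst (\<sigma> \<circ> \<xi>) M"
  by (induction M arbitrary: \<xi> \<sigma>) (simp_all add: dup_comp_ren_up)

lemma dren_comp_dup: "dren (ren_up \<xi>) \<circ> dup \<sigma> = dup (dren \<xi> \<circ> \<sigma>)"
  by (rule ext, rename_tac i, case_tac i) (simp_all add: dren_dren ren_up_comp_Suc)

lemma dren_dinst: "dren \<xi> (dinst \<sigma> M) = dinst (dren \<xi> \<circ> \<sigma>) M"
  by (induction M arbitrary: \<xi> \<sigma>) (simp_all add: dren_comp_dup)

lemma dinst_comp_dup: "dinst (dup \<tau>) \<circ> dup \<sigma> = dup (dinst \<tau> \<circ> \<sigma>)"
proof (rule ext)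
  fix i
  have "dup \<tau> \<circ> Suc = dren Suc \<circ> \<tau>" by (rule ext) simp
  then show "(dinst (dup \<tau>) \<circ> dup \<sigma>) i = dup (dinst \<tau> \<circ> \<sigma>) i"
    by (cases i) (simp_all add: dren_dinst dinst_dren)
qed

lemma dinst_dinst: "dinst \<tau> (dinst \<sigma> M) = dinst (dinst \<tau> \<circ> \<sigma>) M"
  by (induction M arbitrary: \<tau> \<sigma>) (simp_all add: dinst_comp_dup)

lemma dup_DVar [simp]: "dup DVar = DVar"
  by (rule ext, rename_tac i, case_tac i) simp_all

lemma dinst_DVar [simp]: "dinst DVar M = M"
  by (induction M) simp_all

lemma dren_eq_dinst: "dren \<xi> M = dinst (DVar \<circ> \<xi>) M"
proof -
  have "dren \<xi> M = dren \<xi> (dinst DVar M)" by simp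
  also have "\<dots> = dinst (DVar \<circ> \<xi>) M"
    by (simp only: dren_dinst) (rule arg_cong[where f = "\<lambda>\<sigma>. dinst \<sigma> M"], rule ext, simp)
  finally show ?thesis .
qed

lemma dlift_eq_dren: "dlift k M = dren (\<lambda>i. if i < k then i else Suc i) M"
  by (induction M arbitrary: k) (auto simp: ren_up_shift)

lemma dlift_0: "dlift 0 M = dren Suc M"
  by (simp add: dlift_eq_dren)

lemma dsubst_eq_dinst:
  "dsubst M k N = dinst (\<lambda>i. if k < i then DVar (i - 1) else if i = k then N else DVar i) M"
proof (induction M arbitrary: k N)
  have up: "dup (\<lambda>i. if k < i then DVar (i - 1) else if i = k then N else DVar i) =
    (\<lambda>i. if Suc k < i then DVar (i - 1) else if i = Suc k then dlift 0 N else DVar i)"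
    for k and N :: "'b dterm"
    by (rule ext, rename_tac i, case_tac i) (auto simp: dlift_0)
  {
    case (DLam A M)
    then show ?case by (simp add: up)
  next
    case (DPi A M)
    then show ?case by (simp add: up)
  }
qed auto

lemma dsubst_0: "dsubst M 0 N = dinst (N \<cdot> DVar) M"
  unfolding dsubst_eq_dinst
  by (rule arg_cong[where f = "\<lambda>\<sigma>. dinst \<sigma> M"], rule ext, rename_tac i, case_tac i) simp_all

lemma dinst_scons_dup: "dinst (N \<cdot> \<tau>) (dinst (dup \<sigma>) M) = dinst (N \<cdot> (dinst \<tau> \<circ> \<sigma>)) M"
  unfolding dinst_dinst
  by (rule arg_cong[where f = "\<lambda>\<sigma>. dinst \<sigma> M"], rule ext, rename_tac i, case_tac i)
    (simp_all add: dinst_dren)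

lemma dsubst_dinst_dup: "dsubst (dinst (dup \<sigma>) M) 0 N = dinst (N \<cdot> \<sigma>) M"
proof -
  have "dinst DVar \<circ> \<sigma> = \<sigma>" by (rule ext) simp
  then show ?thesis by (simp add: dsubst_0 dinst_scons_dup)
qed

lemma dinst_dsubst: "dinst \<sigma> (dsubst M 0 N) = dsubst (dinst (dup \<sigma>) M) 0 (dinst \<sigma> N)"
proof -
  have "dinst \<sigma> \<circ> DVar = \<sigma>" by (rule ext) simp
  then show ?thesis by (simp add: dsubst_dinst_dup) (simp add: dsubst_0 dinst_dinst comp_scons)
qed

lemma dinst_dup_dlift: "dinst (dup \<sigma>) (dlift 0 M) = dlift 0 (dinst \<sigma> M)"
proof -
  have "dup \<sigma> \<circ> Suc = dren Suc \<circ> \<sigma>" by (rule ext) simp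
  then show ?thesis by (simp add: dlift_0 dinst_dren dren_dinst)
qed

subsection \<open>Confluence\<close>

text \<open>Parallel reduction in the style of Tait and Martin-Loef. A rewrite rule is contracted as
  a whole pattern, down to the constants \<open>Dot\<close> and \<open>PiC\<close>; only the pattern
  variables reduce in the same step.\<close>

inductive dpar :: "('s \<times> 's) set \<Rightarrow> ('s \<times> 's \<times> 's) set \<Rightarrow> 's sconst dterm \<Rightarrow> 's sconst dterm \<Rightarrow> bool"
  for Ax Rl where
  sort: "dpar Ax Rl (DSort s) (DSort s)"
| var: "dpar Ax Rl (DVar i) (DVar i)"
| const: "dpar Ax Rl (DConst c) (DConst c)"
| app: "dpar Ax Rl M M' \<Longrightarrow> dpar Ax Rl N N' \<Longrightarrow> dpar Ax Rl (DApp M N) (DApp M' N')"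
| lam: "dpar Ax Rl A A' \<Longrightarrow> dpar Ax Rl M M' \<Longrightarrow> dpar Ax Rl (DLam A M) (DLam A' M')"
| pi: "dpar Ax Rl A A' \<Longrightarrow> dpar Ax Rl B B' \<Longrightarrow> dpar Ax Rl (DPi A B) (DPi A' B')"
| beta: "dpar Ax Rl M M' \<Longrightarrow> dpar Ax Rl N N' \<Longrightarrow>
    dpar Ax Rl (DApp (DLam A M) N) (dsubst M' 0 N')"
| rw_sort: "(s1, s2) \<in> Ax \<Longrightarrow>
    dpar Ax Rl (DApp (DConst (Eps s2)) (DConst (Dot s1))) (DConst (U s1))"
| rw_pi: "(s1, s2, s3) \<in> Rl \<Longrightarrow> dpar Ax Rl A A' \<Longrightarrow> dpar Ax Rl B B' \<Longrightarrow>
    dpar Ax Rl (DApp (DConst (Eps s3)) (DApp (DApp (DConst (PiC s1 s2 s3)) A) B))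
      (DPi (DApp (DConst (Eps s1)) A') (DApp (DConst (Eps s2)) (DApp (dlift 0 B') (DVar 0))))"

inductive_cases dpar_constE: "dpar Ax Rl (DConst c) N"
inductive_cases dpar_lamE: "dpar Ax Rl (DLam A M) N"
inductive_cases dpar_appE: "dpar Ax Rl (DApp A M) N"
inductive_cases dpar_piE: "dpar Ax Rl (DPi A M) N"

lemma dpar_refl: "dpar Ax Rl M M"
  by (induction M) (auto intro: dpar.intros)

text \<open>Lifting a substitution renames its entries, so stability under renaming has to come
  first. The predicate \<open>P\<close> lets one induction serve both: it is instantiated by equal
  renamings, then by pointwise parallel reduction.\<close>

lemma dpar_dinst_if_dup:
  assumes "dpar Ax Rl M M'"
    and dup: "\<And>\<sigma> \<sigma>'. P \<sigma> \<sigma>' \<Longrightarrow> P (dup \<sigma>) (dup \<sigma>')"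
    and par: "\<And>\<sigma> \<sigma>' i. P \<sigma> \<sigma>' \<Longrightarrow> dpar Ax Rl (\<sigma> i) (\<sigma>' i)"
    and "P \<sigma> \<sigma>'"
  shows "dpar Ax Rl (dinst \<sigma> M) (dinst \<sigma>' M')"
  using assms(1,4)
proof (induction arbitrary: \<sigma> \<sigma>')
  case (beta M M' N N' A)
  then show ?case by (simp add: dinst_dsubst) (blast intro: dpar.beta dup)
next
  case (rw_pi s1 s2 s3 A A' B B')
  then show ?case by (simp add: dinst_dup_dlift) (blast intro: dpar.rw_pi)
next
  case (lam A A' M M')
  then show ?case by (simp add: dpar.lam dup)
next
  case (pi A A' B B')
  then show ?case by (simp add: dpar.pi dup)
qed (auto intro: dpar.intros par)

lemma dpar_dren:
  assumes "dpar Ax Rl M M'" shows "dpar Ax Rl (dren \<xi> M) (dren \<xi> M')"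
  unfolding dren_eq_dinst
proof (rule dpar_dinst_if_dup[where P = "\<lambda>\<sigma> \<sigma>'. \<sigma> = \<sigma>' \<and> (\<exists>\<xi>. \<sigma> = DVar \<circ> \<xi>)"])
  fix \<sigma> \<sigma>' :: "nat \<Rightarrow> 'a sconst dterm"
  assume "\<sigma> = \<sigma>' \<and> (\<exists>\<xi>. \<sigma> = DVar \<circ> \<xi>)"
  then obtain \<xi> where \<xi>: "\<sigma>' = \<sigma>" "\<sigma> = DVar \<circ> \<xi>" by blast
  have "dup (DVar \<circ> \<xi> :: nat \<Rightarrow> 'a sconst dterm) = DVar \<circ> ren_up \<xi>"
    by (rule ext, rename_tac i, case_tac i) simp_all
  with \<xi> show "dup \<sigma> = dup \<sigma>' \<and> (\<exists>\<xi>. dup \<sigma> = DVar \<circ> \<xi>)" by metis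
qed (use assms in \<open>auto intro: dpar.var\<close>)

lemma dpar_dinst:
  assumes "dpar Ax Rl M M'" and "\<And>i. dpar Ax Rl (\<sigma> i) (\<sigma>' i)"
  shows "dpar Ax Rl (dinst \<sigma> M) (dinst \<sigma>' M')"
proof (rule dpar_dinst_if_dup[where P = "\<lambda>\<sigma> \<sigma>'. \<forall>i. dpar Ax Rl (\<sigma> i) (\<sigma>' i)"])
  fix \<sigma> \<sigma>' :: "nat \<Rightarrow> 'a sconst dterm"
  assume *: "\<forall>i. dpar Ax Rl (\<sigma> i) (\<sigma>' i)"
  show "\<forall>i. dpar Ax Rl (dup \<sigma> i) (dup \<sigma>' i)"
  proof
    fix i show "dpar Ax Rl (dup \<sigma> i) (dup \<sigma>' i)"
      using * by (cases i) (auto intro: dpar.var dpar_dren)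
  qed
qed (use assms in auto)

lemma dpar_dsubst:
  assumes "dpar Ax Rl M M'" and "dpar Ax Rl N N'"
  shows "dpar Ax Rl (dsubst M 0 N) (dsubst M' 0 N')"
  unfolding dsubst_0
proof (rule dpar_dinst[OF assms(1)])
  fix i show "dpar Ax Rl ((N \<cdot> DVar) i) ((N' \<cdot> DVar) i)"
    using assms(2) by (cases i) (auto intro: dpar.var)
qed

lemma dpar_dlift: "dpar Ax Rl M M' \<Longrightarrow> dpar Ax Rl (dlift 0 M) (dlift 0 M')"
  by (simp add: dlift_0 dpar_dren)

lemma dpar_PiC_E:
  assumes "dpar Ax Rl (DApp (DApp (DConst (PiC s1 s2 s3)) A) B) N"
  obtains A' B' where "N = DApp (DApp (DConst (PiC s1 s2 s3)) A') B'"
    "dpar Ax Rl A A'" "dpar Ax Rl B B'"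
  using assms by (auto elim!: dpar_appE dpar_constE)

lemma dpar_app_cases:
  assumes "dpar Ax Rl (DApp M N) Q"
  obtains (app) M' N' where "Q = DApp M' N'" "dpar Ax Rl M M'" "dpar Ax Rl N N'"
  | (beta) A P P' N' where "M = DLam A P" "Q = dsubst P' 0 N'" "dpar Ax Rl P P'" "dpar Ax Rl N N'"
  | (rw_sort) s1 s2 where "M = DConst (Eps s2)" "N = DConst (Dot s1)" "Q = DConst (U s1)"
      "(s1, s2) \<in> Ax"
  | (rw_pi) s1 s2 s3 A B A' B' where "M = DConst (Eps s3)"
      "N = DApp (DApp (DConst (PiC s1 s2 s3)) A) B"
      "Q = DPi (DApp (DConst (Eps s1)) A') (DApp (DConst (Eps s2)) (DApp (dlift 0 B') (DVar 0)))"
      "(s1, s2, s3) \<in> Rl" "dpar Ax Rl A A'" "dpar Ax Rl B B'"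
  using assms by cases (blast intro: app beta rw_sort rw_pi)+

lemma dpar_rw_pi_rhs:
  assumes "dpar Ax Rl A A'" "dpar Ax Rl B B'"
  shows "dpar Ax Rl
    (DPi (DApp (DConst (Eps s1)) A) (DApp (DConst (Eps s2)) (DApp (dlift 0 B) (DVar 0))))
    (DPi (DApp (DConst (Eps s1)) A') (DApp (DConst (Eps s2)) (DApp (dlift 0 B') (DVar 0))))"
  using assms by (blast intro: dpar.intros dpar_dlift)

text \<open>The left-hand sides are linear and overlap neither each other nor beta. A redex thus
  survives reduction inside it, and two contractions of it differ only in the reducts of the pattern
  variables.\<close>

lemma dpar_diamond:
  assumes "dpar Ax Rl M P" "dpar Ax Rl M Q"
  shows "\<exists>Z. dpar Ax Rl P Z \<and> dpar Ax Rl Q Z"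
  using assms
proof (induction arbitrary: Q)
  case (app M M' N N')
  from app.prems show ?case
  proof (cases rule: dpar_app_cases)
    case (app M'' N'')
    with app.IH obtain Z W where "dpar Ax Rl M' Z" "dpar Ax Rl M'' Z" "dpar Ax Rl N' W" "dpar Ax Rl N'' W"
      by meson
    with app(1) show ?thesis by (blast intro: dpar.app)
  next
    case (beta A P P' N'')
    from app.hyps(1) beta(1) obtain A' P'' where M': "M' = DLam A' P''" "dpar Ax Rl P P''"
      by (auto elim: dpar_lamE)
    \<comment> \<open>The hypothesis concerns the whole function, so the reduct \<open>P'\<close> of
      the body is put back under the unreduced annotation \<open>A\<close>.\<close>
    from app.IH(1)[of "DLam A P'"] beta(1,3) obtain Z where
      "dpar Ax Rl M' Z" "dpar Ax Rl (DLam A P') Z" by (auto intro: dpar.lam dpar_refl)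
    with M' obtain P3 where P3: "dpar Ax Rl P'' P3" "dpar Ax Rl P' P3"
      by (auto elim!: dpar_lamE)
    from app.IH(2)[OF beta(4)] obtain W where W: "dpar Ax Rl N' W" "dpar Ax Rl N'' W" by blast
    from P3 W M'(1) beta(2) show ?thesis by (blast intro: dpar.beta dpar_dsubst)
  next
    case (rw_sort s1 s2)
    with app.hyps have "M' = M" "N' = N" by (auto elim: dpar_constE)
    with rw_sort show ?thesis by (blast intro: dpar.rw_sort dpar.const)
  next
    case (rw_pi s1 s2 s3 A B A' B')
    from app.hyps(1) rw_pi have M': "M' = M" by (auto elim: dpar_constE)
    from app.hyps(2) rw_pi obtain A2 B2 where N': "N' = DApp (DApp (DConst (PiC s1 s2 s3)) A2) B2"
      by (auto elim: dpar_PiC_E)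
    from app.IH(2)[of "DApp (DApp (DConst (PiC s1 s2 s3)) A') B'"] rw_pi obtain Z where
      Z: "dpar Ax Rl N' Z" "dpar Ax Rl (DApp (DApp (DConst (PiC s1 s2 s3)) A') B') Z"
      by (auto intro: dpar.app dpar.const)
    then obtain A3 B3 where "Z = DApp (DApp (DConst (PiC s1 s2 s3)) A3) B3"
      and 1: "dpar Ax Rl A' A3" "dpar Ax Rl B' B3"
      by (auto elim: dpar_PiC_E)
    with Z(1) N' have 2: "dpar Ax Rl A2 A3" "dpar Ax Rl B2 B3" by (auto elim!: dpar_PiC_E)
    have "dpar Ax Rl Q (DPi (DApp (DConst (Eps s1)) A3)
      (DApp (DConst (Eps s2)) (DApp (dlift 0 B3) (DVar 0))))"
      unfolding rw_pi(3) using 1 by (rule dpar_rw_pi_rhs)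
    moreover have "dpar Ax Rl (DApp M' N') (DPi (DApp (DConst (Eps s1)) A3)
      (DApp (DConst (Eps s2)) (DApp (dlift 0 B3) (DVar 0))))"
      unfolding M' N' rw_pi(1) using rw_pi(4) 2 by (rule dpar.rw_pi)
    ultimately show ?thesis by blast
  qed
next
  case (beta M M' N N' A)
  from beta.prems show ?case
  proof (cases rule: dpar_app_cases)
    case (app L N'')
    from app(2) obtain A' M'' where L: "L = DLam A' M''" "dpar Ax Rl M M''" by (auto elim: dpar_lamE)
    from beta.IH L(2) app(3) obtain Z W where
      "dpar Ax Rl M' Z" "dpar Ax Rl M'' Z" "dpar Ax Rl N' W" "dpar Ax Rl N'' W" by meson
    with app(1) L(1) show ?thesis by (blast intro: dpar.beta dpar_dsubst)
  next
    case (beta B P P' N'')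
    then have "dpar Ax Rl M P'" by simp
    with beta.IH beta(4) obtain Z W where
      "dpar Ax Rl M' Z" "dpar Ax Rl P' Z" "dpar Ax Rl N' W" "dpar Ax Rl N'' W" by meson
    with beta(2) show ?thesis by (blast intro: dpar_dsubst)
  qed simp_all
next
  case (rw_sort s1 s2)
  from rw_sort(2) show ?case
  proof (cases rule: dpar_app_cases)
    case (app M' N')
    then have "Q = DApp (DConst (Eps s2)) (DConst (Dot s1))" by (auto elim: dpar_constE)
    with rw_sort(1) show ?thesis by (blast intro: dpar.rw_sort dpar.const)
  qed (auto intro: dpar.const)
next
  case (rw_pi s1 s2 s3 A A' B B')
  from rw_pi.prems show ?case
  proof (cases rule: dpar_app_cases)
    case (app M' N')
    from app(3) obtain A2 B2 where N': "N' = DApp (DApp (DConst (PiC s1 s2 s3)) A2) B2"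
      "dpar Ax Rl A A2" "dpar Ax Rl B B2" by (auto elim: dpar_PiC_E)
    from app(2) have M': "M' = DConst (Eps s3)" by (auto elim: dpar_constE)
    from rw_pi.IH N'(2,3) obtain Z W where
      *: "dpar Ax Rl A' Z" "dpar Ax Rl A2 Z" "dpar Ax Rl B' W" "dpar Ax Rl B2 W" by meson
    show ?thesis unfolding app(1) N' M'
      using dpar_rw_pi_rhs[OF *(1,3)] dpar.rw_pi[OF rw_pi.hyps(1) *(2,4)] by blast
  next
    case (rw_pi t1 t2 t3 C D C' D')
    then have eq: "t1 = s1" "t2 = s2" "C = A" "D = B" by simp_all
    with rw_pi.IH rw_pi(5,6) obtain Z W where
      *: "dpar Ax Rl A' Z" "dpar Ax Rl C' Z" "dpar Ax Rl B' W" "dpar Ax Rl D' W" by meson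
    show ?thesis unfolding rw_pi(3) eq
      using dpar_rw_pi_rhs[OF *(1,3)] dpar_rw_pi_rhs[OF *(2,4)] by blast
  qed simp_all
next
  case (lam A A' M M')
  from lam.prems show ?case
  proof (rule dpar_lamE)
    fix A2 M2 assume *: "Q = DLam A2 M2" "dpar Ax Rl A A2" "dpar Ax Rl M M2"
    from lam.IH(1)[OF *(2)] lam.IH(2)[OF *(3)] *(1) show ?thesis by (blast intro: dpar.lam)
  qed
next
  case (pi A A' M M')
  from pi.prems show ?case
  proof (rule dpar_piE)
    fix A2 M2 assume *: "Q = DPi A2 M2" "dpar Ax Rl A A2" "dpar Ax Rl M M2"
    from pi.IH(1)[OF *(2)] pi.IH(2)[OF *(3)] *(1) show ?thesis by (blast intro: dpar.pi)
  qed
qed (blast intro: dpar_refl)+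

lemma dstep_imp_dpar: "dstep (rwS Ax Rl) M N \<Longrightarrow> dpar Ax Rl M N"
  by (induction rule: dstep.induct) (auto intro: dpar.intros dpar_refl elim: rwS.cases)

lemma rtranclp_cong2:
  assumes "r\<^sup>*\<^sup>* x x'" "r\<^sup>*\<^sup>* y y'"
    and "\<And>a a' b. r a a' \<Longrightarrow> r (f a b) (f a' b)" "\<And>a b b'. r b b' \<Longrightarrow> r (f a b) (f a b')"
  shows "r\<^sup>*\<^sup>* (f x y) (f x' y')"
proof -
  from assms(1) have "r\<^sup>*\<^sup>* (f x y) (f x' y)"
    by induction (auto intro: assms(3) rtranclp.rtrancl_into_rtrancl)
  moreover from assms(2) have "r\<^sup>*\<^sup>* (f x' y) (f x' y')"
    by induction (auto intro: assms(4) rtranclp.rtrancl_into_rtrancl)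
  ultimately show ?thesis by simp
qed

lemma dsteps_cong:
  assumes "(dstep R)\<^sup>*\<^sup>* A A'" "(dstep R)\<^sup>*\<^sup>* B B'"
  shows "(dstep R)\<^sup>*\<^sup>* (DApp A B) (DApp A' B')"
    and "(dstep R)\<^sup>*\<^sup>* (DLam A B) (DLam A' B')"
    and "(dstep R)\<^sup>*\<^sup>* (DPi A B) (DPi A' B')"
  by (rule rtranclp_cong2[OF assms]; blast intro: dstep.intros)+

lemma dpar_imp_dsteps: "dpar Ax Rl M N \<Longrightarrow> (dstep (rwS Ax Rl))\<^sup>*\<^sup>* M N"
proof (induction rule: dpar.induct)
  case (beta M M' N N' A)
  then have "(dstep (rwS Ax Rl))\<^sup>*\<^sup>* (DApp (DLam A M) N) (DApp (DLam A M') N')"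
    by (intro dsteps_cong) simp_all
  then show ?case by (rule rtranclp.rtrancl_into_rtrancl) (rule dstep.beta)
next
  case (rw_pi s1 s2 s3 A A' B B')
  then have "(dstep (rwS Ax Rl))\<^sup>*\<^sup>* (DApp (DConst (Eps s3)) (DApp (DApp (DConst (PiC s1 s2 s3)) A) B))
    (DApp (DConst (Eps s3)) (DApp (DApp (DConst (PiC s1 s2 s3)) A') B'))"
    by (intro dsteps_cong) simp_all
  with rw_pi.hyps(1) show ?case
    by (blast intro: rtranclp.rtrancl_into_rtrancl dstep.rew rwS.rw_pi)
qed (auto intro: dsteps_cong dstep.rew rwS.rw_sort)

theorem confluentp_dstep: "confluentp (dstep (rwS Ax Rl))"
proof -
  have eq: "(dpar Ax Rl)\<^sup>*\<^sup>* = (dstep (rwS Ax Rl))\<^sup>*\<^sup>*"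
    by (rule rtranclp_subset) (auto dest: dstep_imp_dpar dpar_imp_dsteps)
  have "confluentp (dpar Ax Rl)"
  proof (rule strong_confluentp_imp_confluentp, rule strong_confluentpI)
    fix M P Q assume "dpar Ax Rl M P" "dpar Ax Rl M Q"
    then obtain Z where "dpar Ax Rl P Z" "dpar Ax Rl Q Z" using dpar_diamond by blast
    then show "\<exists>Z. (dpar Ax Rl)\<^sup>*\<^sup>* P Z \<and> (dpar Ax Rl)\<^sup>=\<^sup>= Q Z" by auto
  qed
  then show ?thesis unfolding confluentp_def eq rtranclp_conversep by simp
qed

lemma dconv_joinable:
  assumes "dconv (rwS Ax Rl) M N"
  obtains Z where "(dstep (rwS Ax Rl))\<^sup>*\<^sup>* M Z" "(dstep (rwS Ax Rl))\<^sup>*\<^sup>* N Z"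
  using assms confluentp_imp_semiconfluentp[OF confluentp_dstep, of Ax Rl]
  by (auto simp: semiconfluentp_equivclp rtranclp_conversep)

text \<open>Confluence of \<open>\<beta>\<close> on PTS terms is inherited through an embedding whose image contains no
  redex of the rewrite rules.\<close>

primrec emb :: "'s pterm \<Rightarrow> 's sconst dterm" where
  "emb (PSort s) = DConst (U s)"
| "emb (PVar i) = DVar i"
| "emb (PApp M N) = DApp (emb M) (emb N)"
| "emb (PLam A M) = DLam (emb A) (emb M)"
| "emb (PPi A B) = DPi (emb A) (emb B)"

lemma emb_inject: "emb M = emb N \<Longrightarrow> M = N"
proof (induction M arbitrary: N)
  case (PSort s) then show ?case by (cases N) simp_all
next
  case (PVar i) then show ?case by (cases N) simp_all
next
  case (PApp M1 M2) then show ?case by (cases N) simp_all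
next
  case (PLam A M) then show ?case by (cases N) simp_all
next
  case (PPi A M) then show ?case by (cases N) simp_all
qed

lemma emb_plift: "emb (plift k M) = dlift k (emb M)"
  by (induction M arbitrary: k) simp_all

lemma emb_psubst: "emb (psubst M k N) = dsubst (emb M) k (emb N)"
  by (induction M arbitrary: k N) (simp_all add: emb_plift)

lemma dstep_emb: "pbeta M N \<Longrightarrow> dstep R (emb M) (emb N)"
  by (induction rule: pbeta.induct) (auto simp: emb_psubst intro: dstep.intros)

lemma emb_no_rw: "\<not> rwS Ax Rl (emb M) N"
proof
  assume "rwS Ax Rl (emb M) N"
  then obtain c X where "emb M = DApp (DConst (Eps c)) X" by cases blast+
  then obtain P where "emb P = DConst (Eps c)" by (cases M) auto
  then show False by (cases P) auto
qed

lemma emb_eq_DLam: "emb M = DLam A P \<longleftrightarrow> (\<exists>A' P'. M = PLam A' P' \<and> emb A' = A \<and> emb P' = P)"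
  by (cases M) auto

lemma dstep_embD: "dstep (rwS Ax Rl) (emb M) N \<Longrightarrow> \<exists>M'. pbeta M M' \<and> N = emb M'"
proof (induction M arbitrary: N)
  case (PApp M1 M2)
  from PApp.prems have "dstep (rwS Ax Rl) (DApp (emb M1) (emb M2)) N" by simp
  then show ?case
  proof cases
    case (beta A M)
    then obtain A' P where "M1 = PLam A' P" "emb P = M" by (auto simp: emb_eq_DLam)
    with beta show ?thesis by (metis pbeta.beta emb_psubst)
  next
    case rew
    then show ?thesis using emb_no_rw[of Ax Rl "PApp M1 M2" N] by simp
  next
    case (appL M')
    with PApp.IH(1) show ?thesis by (metis emb.simps(3) pbeta.appL)
  next
    case (appR N')
    with PApp.IH(2) show ?thesis by (metis emb.simps(3) pbeta.appR)
  qed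
next
  case (PLam A M)
  from PLam.prems have "dstep (rwS Ax Rl) (DLam (emb A) (emb M)) N" by simp
  then show ?case
  proof cases
    case rew
    then show ?thesis using emb_no_rw[of Ax Rl "PLam A M" N] by simp
  next
    case (lamL M')
    with PLam.IH(1) show ?thesis by (metis emb.simps(4) pbeta.lamL)
  next
    case (lamR N')
    with PLam.IH(2) show ?thesis by (metis emb.simps(4) pbeta.lamR)
  qed
next
  case (PPi A M)
  from PPi.prems have "dstep (rwS Ax Rl) (DPi (emb A) (emb M)) N" by simp
  then show ?case
  proof cases
    case rew
    then show ?thesis using emb_no_rw[of Ax Rl "PPi A M" N] by simp
  next
    case (piL M')
    with PPi.IH(1) show ?thesis by (metis emb.simps(5) pbeta.piL)
  next
    case (piR N')
    with PPi.IH(2) show ?thesis by (metis emb.simps(5) pbeta.piR)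
  qed
qed (auto elim: dstep.cases rwS.cases)

lemma dsteps_embD:
  assumes "(dstep (rwS Ax Rl))\<^sup>*\<^sup>* (emb M) N" shows "\<exists>M'. pbeta\<^sup>*\<^sup>* M M' \<and> N = emb M'"
  using assms by induction (auto dest: dstep_embD intro: rtranclp.rtrancl_into_rtrancl)

lemma equivclp_map:
  assumes "equivclp r x y" and "\<And>x y. r x y \<Longrightarrow> equivclp r' (f x) (f y)"
  shows "equivclp r' (f x) (f y)"
  using assms(1)
proof induction
  case (step y z)
  then show ?case using assms(2) by (meson equivclp_sym equivclp_trans)
qed simp

lemma pconv_joinable:
  assumes "pconv M N"
  obtains Z where "pbeta\<^sup>*\<^sup>* M Z" "pbeta\<^sup>*\<^sup>* N Z"
proof -
  have "dconv (rwS {} {}) (emb M) (emb N)"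
    using assms by (rule equivclp_map) (blast intro: dstep_emb)
  then obtain Z where "(dstep (rwS {} {}))\<^sup>*\<^sup>* (emb M) Z" "(dstep (rwS {} {}))\<^sup>*\<^sup>* (emb N) Z"
    by (rule dconv_joinable)
  then show ?thesis using that by (metis dsteps_embD emb_inject)
qed

subsection \<open>Conversion of PTS terms\<close>

lemma equivclp_cong2:
  assumes "equivclp r x x'" "equivclp r y y'"
    and "\<And>a a' b. r a a' \<Longrightarrow> r (f a b) (f a' b)" "\<And>a b b'. r b b' \<Longrightarrow> r (f a b) (f a b')"
  shows "equivclp r (f x y) (f x' y')"
proof -
  from assms(1) have "equivclp r (f x y) (f x' y)" by (rule equivclp_map) (blast intro: assms)
  also from assms(2) have "equivclp r (f x' y) (f x' y')" by (rule equivclp_map) (blast intro: assms)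
  finally show ?thesis .
qed

lemma pconv_cong:
  assumes "pconv A A'" "pconv B B'"
  shows pconv_app: "pconv (PApp A B) (PApp A' B')"
    and pconv_lam: "pconv (PLam A B) (PLam A' B')"
    and pconv_pi: "pconv (PPi A B) (PPi A' B')"
  by (rule equivclp_cong2[OF assms]; blast intro: pbeta.intros)+

lemma pbeta_pinst: "pbeta M N \<Longrightarrow> pbeta (pinst \<sigma> M) (pinst \<sigma> N)"
  by (induction arbitrary: \<sigma> rule: pbeta.induct) (simp_all add: pinst_psubst pbeta.intros)

lemma pconv_pinst: "pconv M N \<Longrightarrow> pconv (pinst \<sigma> M) (pinst \<sigma> N)"
  by (erule equivclp_map) (blast intro: pbeta_pinst)

lemma pconv_pren: "pconv M N \<Longrightarrow> pconv (pren \<xi> M) (pren \<xi> N)"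
  by (simp add: pren_eq_pinst pconv_pinst)

lemma pconv_pinst_subst:
  assumes "\<And>i. pconv (\<sigma> i) (\<sigma>' i)" shows "pconv (pinst \<sigma> M) (pinst \<sigma>' M)"
  using assms
proof (induction M arbitrary: \<sigma> \<sigma>')
  have up: "pconv (pup \<sigma> i) (pup \<sigma>' i)" if "\<And>i. pconv (\<sigma> i) (\<sigma>' i)"
    for \<sigma> \<sigma>' :: "nat \<Rightarrow> 'b pterm" and i
    using that by (cases i) (simp_all add: pconv_pren)
  {
    case (PLam A M)
    then show ?case by (simp add: pconv_lam up)
  next
    case (PPi A M)
    then show ?case by (simp add: pconv_pi up)
  }
qed (simp_all add: pconv_app)

lemma pconv_psubst:
  assumes "pconv M M'" "pconv N N'" shows "pconv (psubst M 0 N) (psubst M' 0 N')"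
proof -
  have "pconv (pinst (N \<cdot> PVar) M) (pinst (N \<cdot> PVar) M')" using assms(1) by (rule pconv_pinst)
  also have "pconv (pinst (N \<cdot> PVar) M') (pinst (N' \<cdot> PVar) M')"
  proof (rule pconv_pinst_subst)
    fix i show "pconv ((N \<cdot> PVar) i) ((N' \<cdot> PVar) i)" using assms(2) by (cases i) simp_all
  qed
  finally show ?thesis by (simp add: psubst_0)
qed

lemma pconv_beta: "pconv (PApp (PLam A M) N) (psubst M 0 N)"
  by (blast intro: pbeta.beta)

lemma pbetas_pi:
  assumes "pbeta\<^sup>*\<^sup>* (PPi A B) C"
  shows "\<exists>A' B'. C = PPi A' B' \<and> pbeta\<^sup>*\<^sup>* A A' \<and> pbeta\<^sup>*\<^sup>* B B'"
  using assms
proof induction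
  case (step C D)
  then obtain A' B' where *: "C = PPi A' B'" "pbeta\<^sup>*\<^sup>* A A'" "pbeta\<^sup>*\<^sup>* B B'" by blast
  from step(2) show ?case unfolding *(1)
    by cases (use *(2,3) in \<open>auto intro: rtranclp.rtrancl_into_rtrancl\<close>)
qed blast

lemma pbetas_sort: "pbeta\<^sup>*\<^sup>* (PSort s) C \<Longrightarrow> C = PSort s"
  by (induction rule: rtranclp_induct) (auto elim: pbeta.cases)

lemma pconv_pi_inject:
  assumes "pconv (PPi A B) (PPi A' B')" shows "pconv A A'" "pconv B B'"
proof -
  from assms obtain Z where "pbeta\<^sup>*\<^sup>* (PPi A B) Z" "pbeta\<^sup>*\<^sup>* (PPi A' B') Z" by (rule pconv_joinable)
  then obtain X Y where "pbeta\<^sup>*\<^sup>* A X" "pbeta\<^sup>*\<^sup>* A' X" "pbeta\<^sup>*\<^sup>* B Y" "pbeta\<^sup>*\<^sup>* B' Y"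
    by (metis pbetas_pi pterm.inject(5))
  then show "pconv A A'" "pconv B B'"
    by (meson rtranclp_into_equivclp equivclp_sym equivclp_trans)+
qed

text \<open>Typing follows a reduction by subject reduction, but follows a conversion only to a type
  already known to be typable. Confluence trades the conversion for a reduction, at the price of
  merely convertible components.\<close>

lemma pconv_pi_reduct:
  assumes "pconv C (PPi A B)"
  obtains A' B' where "pbeta\<^sup>*\<^sup>* C (PPi A' B')" "pconv A A'" "pconv B B'"
proof -
  from assms obtain Z where Z: "pbeta\<^sup>*\<^sup>* C Z" "pbeta\<^sup>*\<^sup>* (PPi A B) Z" by (rule pconv_joinable)
  then obtain X Y where "Z = PPi X Y" "pbeta\<^sup>*\<^sup>* A X" "pbeta\<^sup>*\<^sup>* B Y" using pbetas_pi by blast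
  with Z(1) that show ?thesis by (blast intro: rtranclp_into_equivclp)
qed

lemma pconv_sort_reduct: "pconv C (PSort s) \<Longrightarrow> pbeta\<^sup>*\<^sup>* C (PSort s)"
  by (metis pconv_joinable pbetas_sort)

lemma pconv_sort_inject: "pconv (PSort s) (PSort t) \<Longrightarrow> s = t"
  by (metis pconv_sort_reduct pbetas_sort pterm.inject(1))

subsection \<open>Metatheory of pure type systems\<close>

definition lookup :: "'s pterm list \<Rightarrow> nat \<Rightarrow> 's pterm" where
  "lookup \<Gamma> i = (plift 0 ^^ Suc i) (\<Gamma> ! i)"

lemma lookup_simps [simp]:
  "lookup (A # \<Gamma>) 0 = pren Suc A"
  "lookup (A # \<Gamma>) (Suc i) = pren Suc (lookup \<Gamma> i)"
  by (simp_all add: lookup_def plift_0)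

locale pts =
  fixes Ax :: "('s \<times> 's) set" and Rl :: "('s \<times> 's \<times> 's) set"
begin

abbreviation pwf :: "'s pterm list \<Rightarrow> bool" where
  "pwf \<equiv> pts_wf Ax Rl"

abbreviation ptyp :: "'s pterm list \<Rightarrow> 's pterm \<Rightarrow> 's pterm \<Rightarrow> bool" ("_ \<turnstile> _ : _" [51, 51, 51] 50) where
  "ptyp \<equiv> pts_typ Ax Rl"

lemmas typ_induct = pts_wf_pts_typ.inducts(2)
  [where ?P1.0 = "\<lambda>_. True", consumes 1,
   case_names wf_nil wf_cons t_var t_sort t_pi t_lam t_app t_conv]

lemmas pwf_Cons = pts_wf_pts_typ.wf_cons
lemmas ptyp_sort = pts_wf_pts_typ.t_sort
lemmas ptyp_pi = pts_wf_pts_typ.t_pi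
lemmas ptyp_lam = pts_wf_pts_typ.t_lam
lemmas ptyp_app = pts_wf_pts_typ.t_app
lemmas ptyp_conv = pts_wf_pts_typ.t_conv

lemma ptyp_var: "pwf \<Gamma> \<Longrightarrow> i < length \<Gamma> \<Longrightarrow> \<Gamma> \<turnstile> PVar i : lookup \<Gamma> i"
  unfolding lookup_def by (rule pts_wf_pts_typ.t_var)

lemma typ_imp_wf: "\<Gamma> \<turnstile> M : A \<Longrightarrow> pwf \<Gamma>"
  by (induction rule: typ_induct) simp_all

lemma wf_ConsD:
  assumes "pwf (A # \<Gamma>)" shows "pwf \<Gamma>" "\<exists>s. \<Gamma> \<turnstile> A : PSort s"
  using assms by (auto elim: pts_wf.cases dest: typ_imp_wf)

text \<open>The accessibility relation of the Kripke worlds. Only the types of variables are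
  compared, so \<open>\<xi>\<close> may be neither injective nor monotone.\<close>

definition ren_ok :: "'s pterm list \<Rightarrow> (nat \<Rightarrow> nat) \<Rightarrow> 's pterm list \<Rightarrow> bool" where
  "ren_ok \<Gamma> \<xi> \<Delta> \<longleftrightarrow> pwf \<Delta> \<and>
     (\<forall>i < length \<Gamma>. \<xi> i < length \<Delta> \<and> lookup \<Delta> (\<xi> i) = pren \<xi> (lookup \<Gamma> i))"

lemma ren_ok_id: "pwf \<Gamma> \<Longrightarrow> ren_ok \<Gamma> id \<Gamma>"
  by (simp add: ren_ok_def)

lemma ren_ok_Suc: "\<Gamma> \<turnstile> A : PSort s \<Longrightarrow> ren_ok \<Gamma> Suc (A # \<Gamma>)"
  by (auto simp: ren_ok_def intro: pwf_Cons)

lemma ren_ok_comp: "ren_ok \<Gamma> \<xi> \<Delta> \<Longrightarrow> ren_ok \<Delta> \<zeta> \<Theta> \<Longrightarrow> ren_ok \<Gamma> (\<zeta> \<circ> \<xi>) \<Theta>"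
  by (auto simp: ren_ok_def pren_pren)

lemma ren_ok_up:
  assumes "ren_ok \<Gamma> \<xi> \<Delta>" "\<Delta> \<turnstile> pren \<xi> A : PSort s"
  shows "ren_ok (A # \<Gamma>) (ren_up \<xi>) (pren \<xi> A # \<Delta>)"
  unfolding ren_ok_def
proof (intro conjI allI impI)
  fix i assume "i < length (A # \<Gamma>)"
  then show "ren_up \<xi> i < length (pren \<xi> A # \<Delta>)"
    "lookup (pren \<xi> A # \<Delta>) (ren_up \<xi> i) = pren (ren_up \<xi>) (lookup (A # \<Gamma>) i)"
    using assms(1) by (cases i; simp add: ren_ok_def pren_pren ren_up_comp_Suc)+
qed (use assms(2) in \<open>blast intro: pwf_Cons\<close>)

text \<open>The second conjunct makes the domain of a product available in the abstraction case, where
  its typing is not an immediate subderivation.\<close>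

lemma typ_pren_aux:
  assumes "\<Gamma> \<turnstile> M : A"
  shows "(\<forall>\<xi> \<Delta>. ren_ok \<Gamma> \<xi> \<Delta> \<longrightarrow> (\<Delta> \<turnstile> pren \<xi> M : pren \<xi> A)) \<and>
    (\<forall>X Y. M = PPi X Y \<longrightarrow> (\<exists>s. \<forall>\<xi> \<Delta>. ren_ok \<Gamma> \<xi> \<Delta> \<longrightarrow> (\<Delta> \<turnstile> pren \<xi> X : PSort s)))"
  using assms
proof (induction rule: typ_induct)
  case (t_var \<Gamma> i)
  then show ?case
    unfolding lookup_def[symmetric] by (auto simp: ren_ok_def) (metis pts.ptyp_var)
next
  case (t_sort \<Gamma> s1 s2)
  then show ?case by (auto simp: ren_ok_def intro: ptyp_sort)
next
  case (t_pi \<Gamma> A s1 B s2 s3)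
  then show ?case by simp (blast intro: ptyp_pi ren_ok_up)
next
  case (t_lam A \<Gamma> M B s)
  then obtain t where t: "\<Delta> \<turnstile> pren \<xi> A : PSort t" if "ren_ok \<Gamma> \<xi> \<Delta>" for \<xi> \<Delta> by blast
  have "\<Delta> \<turnstile> PLam (pren \<xi> A) (pren (ren_up \<xi>) M) : PPi (pren \<xi> A) (pren (ren_up \<xi>) B)"
    if "ren_ok \<Gamma> \<xi> \<Delta>" for \<xi> \<Delta>
    using t_lam.IH t[OF that] that by (intro ptyp_lam) (auto intro: ren_ok_up)
  then show ?case by simp
next
  case (t_app \<Gamma> M A B N)
  then show ?case by (simp add: pren_psubst) (blast intro: ptyp_app)
next
  case (t_conv \<Gamma> M A B s)
  then show ?case by simp (blast intro: ptyp_conv pconv_pren)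
qed simp_all

lemma typ_pren: "\<Gamma> \<turnstile> M : A \<Longrightarrow> ren_ok \<Gamma> \<xi> \<Delta> \<Longrightarrow> \<Delta> \<turnstile> pren \<xi> M : pren \<xi> A"
  using typ_pren_aux by blast

lemma typ_weaken: "\<Gamma> \<turnstile> M : A \<Longrightarrow> \<Gamma> \<turnstile> B : PSort s \<Longrightarrow> B # \<Gamma> \<turnstile> pren Suc M : pren Suc A"
  by (rule typ_pren[OF _ ren_ok_Suc])

lemma typ_var_0: "\<Gamma> \<turnstile> A : PSort s \<Longrightarrow> A # \<Gamma> \<turnstile> PVar 0 : pren Suc A"
  using ptyp_var[of "A # \<Gamma>" 0] by (simp add: pwf_Cons)

definition subst_ok :: "'s pterm list \<Rightarrow> (nat \<Rightarrow> 's pterm) \<Rightarrow> 's pterm list \<Rightarrow> bool" where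
  "subst_ok \<Gamma> \<sigma> \<Delta> \<longleftrightarrow> pwf \<Delta> \<and> (\<forall>i < length \<Gamma>. \<Delta> \<turnstile> \<sigma> i : pinst \<sigma> (lookup \<Gamma> i))"

lemma subst_ok_up:
  assumes "subst_ok \<Gamma> \<sigma> \<Delta>" "\<Delta> \<turnstile> pinst \<sigma> A : PSort s"
  shows "subst_ok (A # \<Gamma>) (pup \<sigma>) (pinst \<sigma> A # \<Delta>)"
  unfolding subst_ok_def
proof (intro conjI allI impI)
  have Suc: "pup \<sigma> \<circ> Suc = pren Suc \<circ> \<sigma>" by (rule ext) simp
  fix i assume i: "i < length (A # \<Gamma>)"
  show "pinst \<sigma> A # \<Delta> \<turnstile> pup \<sigma> i : pinst (pup \<sigma>) (lookup (A # \<Gamma>) i)"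
  proof (cases i)
    case 0
    then show ?thesis using typ_var_0[OF assms(2)] by (simp add: pinst_pren Suc pren_pinst)
  next
    case [simp]: (Suc j)
    with i assms(1) have "\<Delta> \<turnstile> \<sigma> j : pinst \<sigma> (lookup \<Gamma> j)" by (simp add: subst_ok_def)
    from typ_weaken[OF this assms(2)] show ?thesis
      by (simp add: pinst_pren \<open>pup \<sigma> \<circ> Suc = pren Suc \<circ> \<sigma>\<close> pren_pinst)
  qed
qed (use assms(2) in \<open>blast intro: pwf_Cons\<close>)

text \<open>As for renamings, the second conjunct supplies the domain in the abstraction
  case.\<close>

lemma typ_pinst_aux:
  assumes "\<Gamma> \<turnstile> M : A"
  shows "(\<forall>\<sigma> \<Delta>. subst_ok \<Gamma> \<sigma> \<Delta> \<longrightarrow> (\<Delta> \<turnstile> pinst \<sigma> M : pinst \<sigma> A)) \<and>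
    (\<forall>X Y. M = PPi X Y \<longrightarrow> (\<exists>s. \<forall>\<sigma> \<Delta>. subst_ok \<Gamma> \<sigma> \<Delta> \<longrightarrow> (\<Delta> \<turnstile> pinst \<sigma> X : PSort s)))"
  using assms
proof (induction rule: typ_induct)
  case (t_var \<Gamma> i)
  then show ?case
    unfolding lookup_def[symmetric] by (auto simp: subst_ok_def)
next
  case (t_sort \<Gamma> s1 s2)
  then show ?case by (auto simp: subst_ok_def intro: ptyp_sort)
next
  case (t_pi \<Gamma> A s1 B s2 s3)
  then show ?case by simp (blast intro: ptyp_pi subst_ok_up)
next
  case (t_lam A \<Gamma> M B s)
  then obtain t where t: "\<Delta> \<turnstile> pinst \<sigma> A : PSort t" if "subst_ok \<Gamma> \<sigma> \<Delta>" for \<sigma> \<Delta> by blast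
  have "\<Delta> \<turnstile> PLam (pinst \<sigma> A) (pinst (pup \<sigma>) M) : PPi (pinst \<sigma> A) (pinst (pup \<sigma>) B)"
    if "subst_ok \<Gamma> \<sigma> \<Delta>" for \<sigma> \<Delta>
    using t_lam.IH t[OF that] that by (intro ptyp_lam) (auto intro: subst_ok_up)
  then show ?case by simp
next
  case (t_app \<Gamma> M A B N)
  then show ?case by (simp add: pinst_psubst) (blast intro: ptyp_app)
next
  case (t_conv \<Gamma> M A B s)
  then show ?case by simp (blast intro: ptyp_conv pconv_pinst)
qed simp_all

lemma typ_pinst: "\<Gamma> \<turnstile> M : A \<Longrightarrow> subst_ok \<Gamma> \<sigma> \<Delta> \<Longrightarrow> \<Delta> \<turnstile> pinst \<sigma> M : pinst \<sigma> A"
  using typ_pinst_aux by blast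

lemma pinst_scons_pren_Suc: "pinst (N \<cdot> \<sigma>) (pren Suc M) = pinst \<sigma> M"
  by (simp add: pinst_pren)

lemma typ_psubst:
  assumes "A # \<Gamma> \<turnstile> M : B" "\<Gamma> \<turnstile> N : A" shows "\<Gamma> \<turnstile> psubst M 0 N : psubst B 0 N"
  unfolding psubst_0
proof (rule typ_pinst[OF assms(1)], unfold subst_ok_def, intro conjI allI impI)
  show wf: "pwf \<Gamma>" using assms(2) by (rule typ_imp_wf)
  fix i assume "i < length (A # \<Gamma>)"
  then show "\<Gamma> \<turnstile> (N \<cdot> PVar) i : pinst (N \<cdot> PVar) (lookup (A # \<Gamma>) i)"
    using assms(2) ptyp_var[OF wf] by (cases i) (simp_all add: pinst_scons_pren_Suc)
qed

text \<open>The identity substitution is well typed between the two contexts: only variable 0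
  changes its type, and a conversion repairs it.\<close>

lemma typ_ctx_conv:
  assumes "A # \<Gamma> \<turnstile> M : B" "\<Gamma> \<turnstile> A' : PSort s" "pconv A A'"
  shows "A' # \<Gamma> \<turnstile> M : B"
proof -
  obtain t where t: "\<Gamma> \<turnstile> A : PSort t" using assms(1) by (blast dest: typ_imp_wf wf_ConsD)
  have "subst_ok (A # \<Gamma>) PVar (A' # \<Gamma>)"
    unfolding subst_ok_def
  proof (intro conjI allI impI)
    show wf: "pwf (A' # \<Gamma>)" using assms(2) by (rule pwf_Cons)
    fix i assume i: "i < length (A # \<Gamma>)"
    have "A' # \<Gamma> \<turnstile> PVar 0 : pren Suc A"
      using typ_var_0[OF assms(2)] typ_weaken[OF t assms(2)] assms(3)
      by (auto intro: ptyp_conv pconv_pren equivclp_sym)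
    then show "A' # \<Gamma> \<turnstile> PVar i : pinst PVar (lookup (A # \<Gamma>) i)"
      using i ptyp_var[OF wf, of i] by (cases i) simp_all
  qed
  from typ_pinst[OF assms(1) this] show ?thesis by simp
qed

lemma typ_generation:
  assumes "\<Gamma> \<turnstile> M : C"
  shows "case M of
      PSort s \<Rightarrow> \<exists>s'. (s, s') \<in> Ax \<and> pconv (PSort s') C
    | PVar i \<Rightarrow> pconv (lookup \<Gamma> i) C
    | PApp P N \<Rightarrow> \<exists>A B. (\<Gamma> \<turnstile> P : PPi A B) \<and> (\<Gamma> \<turnstile> N : A) \<and> pconv (psubst B 0 N) C
    | PLam A P \<Rightarrow> \<exists>B s. (A # \<Gamma> \<turnstile> P : B) \<and> (\<Gamma> \<turnstile> PPi A B : PSort s) \<and> pconv (PPi A B) C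
    | PPi A B \<Rightarrow> \<exists>s1 s2 s3. (\<Gamma> \<turnstile> A : PSort s1) \<and> (A # \<Gamma> \<turnstile> B : PSort s2) \<and> (s1, s2, s3) \<in> Rl \<and>
        pconv (PSort s3) C"
  using assms
proof (induction rule: typ_induct)
  case (t_var \<Gamma> i)
  then show ?case by (simp add: lookup_def)
next
  case (t_sort \<Gamma> s1 s2)
  then show ?case by auto
next
  case (t_pi \<Gamma> A s1 B s2 s3)
  then show ?case by simp (blast intro: equivclp_refl)
next
  case (t_lam A \<Gamma> M B s)
  then show ?case by simp (blast intro: equivclp_refl)
next
  case (t_app \<Gamma> M A B N)
  then show ?case by simp (blast intro: equivclp_refl)
next
  case (t_conv \<Gamma> M A B s)
  then show ?case by (simp split: pterm.splits) (blast intro: equivclp_trans)+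
qed simp_all

lemma typ_sortE:
  assumes "\<Gamma> \<turnstile> PSort s : C" obtains s' where "(s, s') \<in> Ax" "pconv (PSort s') C"
  using typ_generation[OF assms] by auto

lemma typ_piE:
  assumes "\<Gamma> \<turnstile> PPi A B : C"
  obtains s1 s2 s3 where "\<Gamma> \<turnstile> A : PSort s1" "A # \<Gamma> \<turnstile> B : PSort s2" "(s1, s2, s3) \<in> Rl"
    "pconv (PSort s3) C"
  using typ_generation[OF assms] by auto

lemma typ_lamE:
  assumes "\<Gamma> \<turnstile> PLam A M : C"
  obtains B s where "A # \<Gamma> \<turnstile> M : B" "\<Gamma> \<turnstile> PPi A B : PSort s" "pconv (PPi A B) C"
  using typ_generation[OF assms] by auto

lemma typ_appE:
  assumes "\<Gamma> \<turnstile> PApp M N : C"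
  obtains A B where "\<Gamma> \<turnstile> M : PPi A B" "\<Gamma> \<turnstile> N : A" "pconv (psubst B 0 N) C"
  using typ_generation[OF assms] by auto

lemma lookup_typ: "pwf \<Gamma> \<Longrightarrow> i < length \<Gamma> \<Longrightarrow> \<exists>s. \<Gamma> \<turnstile> lookup \<Gamma> i : PSort s"
proof (induction \<Gamma> arbitrary: i)
  case (Cons A \<Gamma>)
  then obtain s where s: "\<Gamma> \<turnstile> A : PSort s" using wf_ConsD by blast
  show ?case
  proof (cases i)
    case 0
    then show ?thesis using typ_weaken[OF s s] by auto
  next
    case (Suc j)
    with Cons.prems have "pwf \<Gamma>" "j < length \<Gamma>" by (auto dest: wf_ConsD)
    then obtain t where "\<Gamma> \<turnstile> lookup \<Gamma> j : PSort t" using Cons.IH by blast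
    from typ_weaken[OF this s] Suc show ?thesis by auto
  qed
qed simp

lemma typ_correct:
  assumes "\<Gamma> \<turnstile> M : A" shows "(\<exists>s. \<Gamma> \<turnstile> A : PSort s) \<or> (\<exists>s. A = PSort s)"
  using assms
proof (induction rule: typ_induct)
  case (t_var \<Gamma> i)
  then show ?case unfolding lookup_def[symmetric] using lookup_typ by blast
next
  case (t_app \<Gamma> M A B N)
  then obtain s where "\<Gamma> \<turnstile> PPi A B : PSort s" by auto
  then obtain s2 where "A # \<Gamma> \<turnstile> B : PSort s2" by (rule typ_piE)
  from typ_psubst[OF this t_app.hyps(2)] show ?case by auto
qed auto

lemma typ_pi_typ:
  assumes "\<Gamma> \<turnstile> M : PPi A B"
  obtains s1 s2 where "\<Gamma> \<turnstile> A : PSort s1" "A # \<Gamma> \<turnstile> B : PSort s2"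
  using typ_correct[OF assms] by (auto elim: typ_piE)

text \<open>Injectivity of products, obtained from confluence, settles the beta case. Where a step
  changes the type assigned (a new annotation, a new argument), the old type is still typable and
  the result is converted back to it.\<close>

lemma subject_reduction1:
  assumes "\<Gamma> \<turnstile> M : A" "pbeta M M'" shows "\<Gamma> \<turnstile> M' : A"
  using assms
proof (induction arbitrary: M' rule: typ_induct)
  case (t_var \<Gamma> i)
  then show ?case by (auto elim: pbeta.cases)
next
  case (t_sort \<Gamma> s1 s2)
  then show ?case by (auto elim: pbeta.cases)
next
  case (t_pi \<Gamma> A s1 B s2 s3)
  from t_pi.prems show ?case
  proof cases
    case (piL A')
    then have "\<Gamma> \<turnstile> A' : PSort s1" using t_pi.IH(1) by blast
    then show ?thesis
      using piL t_pi.hyps by (blast intro: ptyp_pi typ_ctx_conv)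
  next
    case (piR B')
    then show ?thesis using t_pi by (blast intro: ptyp_pi)
  qed
next
  case (t_lam A \<Gamma> M B s)
  from t_lam.prems show ?case
  proof cases
    case (lamL A')
    have pi: "\<Gamma> \<turnstile> PPi A' B : PSort s" using lamL t_lam.IH(2) by (blast intro: pbeta.piL)
    then obtain s1 where "\<Gamma> \<turnstile> A' : PSort s1" by (rule typ_piE)
    then have "A' # \<Gamma> \<turnstile> M : B" using lamL t_lam.hyps by (blast intro: typ_ctx_conv)
    then have "\<Gamma> \<turnstile> PLam A' M : PPi A' B" using pi by (rule ptyp_lam)
    then show ?thesis unfolding lamL(1) using t_lam.hyps(2)
      by (rule ptyp_conv) (use lamL(2) in \<open>blast intro: pbeta.piL\<close>)
  next
    case (lamR M'')
    then show ?thesis using t_lam by (blast intro: ptyp_lam)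
  qed
next
  case (t_app \<Gamma> M A B N)
  obtain s1 s2 where s: "\<Gamma> \<turnstile> A : PSort s1" "A # \<Gamma> \<turnstile> B : PSort s2"
    using t_app.hyps(1) by (rule typ_pi_typ)
  have B: "\<Gamma> \<turnstile> psubst B 0 N : PSort s2" using typ_psubst[OF s(2) t_app.hyps(2)] by simp
  from t_app.prems show ?case
  proof cases
    case (beta A' P)
    with t_app.hyps(1) have "\<Gamma> \<turnstile> PLam A' P : PPi A B" by simp
    then obtain B' t where *: "A' # \<Gamma> \<turnstile> P : B'" "\<Gamma> \<turnstile> PPi A' B' : PSort t"
      and "pconv (PPi A' B') (PPi A B)" by (rule typ_lamE)
    then have c: "pconv A A'" "pconv B' B" by (blast intro: equivclp_sym dest: pconv_pi_inject)+
    from *(2) obtain t1 where "\<Gamma> \<turnstile> A' : PSort t1" by (rule typ_piE)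
    with t_app.hyps(2) c have "\<Gamma> \<turnstile> N : A'" by (blast intro: ptyp_conv)
    from typ_psubst[OF *(1) this] have "\<Gamma> \<turnstile> psubst P 0 N : psubst B' 0 N" .
    then show ?thesis unfolding beta using B c
      by (blast intro: ptyp_conv pconv_psubst equivclp_refl)
  next
    case (appL M'')
    then show ?thesis using t_app by (blast intro: ptyp_app)
  next
    case (appR N')
    then have "\<Gamma> \<turnstile> PApp M N' : psubst B 0 N'" using t_app by (blast intro: ptyp_app)
    moreover have "pconv (psubst B 0 N') (psubst B 0 N)"
      using appR by (blast intro: pconv_psubst equivclp_refl)
    ultimately show ?thesis unfolding appR using B by (blast intro: ptyp_conv)
  qed
next
  case (t_conv \<Gamma> M A B s)
  then show ?case by (blast intro: ptyp_conv)
qed simp_all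

lemma subject_reduction: "pbeta\<^sup>*\<^sup>* M M' \<Longrightarrow> \<Gamma> \<turnstile> M : A \<Longrightarrow> \<Gamma> \<turnstile> M' : A"
  by (induction rule: rtranclp_induct) (auto intro: subject_reduction1)

text \<open>A type that is not a sort is typable and keeps its sort under reduction, so the
  conversion rule applies. A sort may be untypable, but it is normal.\<close>

lemma typ_reduce_type:
  assumes "\<Gamma> \<turnstile> M : A" "pbeta\<^sup>*\<^sup>* A A'" shows "\<Gamma> \<turnstile> M : A'"
proof (cases "\<exists>s. A = PSort s")
  case True
  with assms show ?thesis by (auto dest: pbetas_sort)
next
  case False
  with typ_correct[OF assms(1)] obtain s where "\<Gamma> \<turnstile> A : PSort s" by blast
  with assms(2) have "\<Gamma> \<turnstile> A' : PSort s" by (rule subject_reduction)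
  with assms(1) show ?thesis using rtranclp_into_equivclp[OF assms(2)] by (rule ptyp_conv)
qed

lemma typ_conv_sort: "\<Gamma> \<turnstile> M : A \<Longrightarrow> pconv A (PSort s) \<Longrightarrow> \<Gamma> \<turnstile> M : PSort s"
  by (blast intro: typ_reduce_type pconv_sort_reduct)

lemma typ_conv_pi:
  assumes "\<Gamma> \<turnstile> M : C" "pconv C (PPi A B)"
  obtains A' B' where "\<Gamma> \<turnstile> M : PPi A' B'" "pconv A A'" "pconv B B'"
  using assms by (meson pconv_pi_reduct typ_reduce_type)

end

section \<open>Uniqueness of types for functional specifications\<close>

locale functional_pts = pts Ax Rl
  for Ax :: "('s \<times> 's) set" and Rl :: "('s \<times> 's \<times> 's) set" +
  assumes functional: "functional_spec Ax Rl"
begin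

lemma functional_Ax: "(s, t) \<in> Ax \<Longrightarrow> (s, t') \<in> Ax \<Longrightarrow> t = t'"
  using functional unfolding functional_spec_def by blast

lemma functional_Rl: "(s1, s2, s3) \<in> Rl \<Longrightarrow> (s1, s2, s3') \<in> Rl \<Longrightarrow> s3 = s3'"
  using functional unfolding functional_spec_def by blast

lemma typ_unique: "\<Gamma> \<turnstile> M : A \<Longrightarrow> \<Gamma> \<turnstile> M : A' \<Longrightarrow> pconv A A'"
proof (induction M arbitrary: \<Gamma> A A')
  case (PSort s)
  then show ?case by (metis typ_sortE functional_Ax equivclp_sym equivclp_trans)
next
  case (PVar i)
  from typ_generation[OF PVar(1)] typ_generation[OF PVar(2)] show ?case
    by simp (meson equivclp_sym equivclp_trans)
next
  case (PApp M N)
  from PApp.prems(1) obtain B C where 1: "\<Gamma> \<turnstile> M : PPi B C" "pconv (psubst C 0 N) A" by (rule typ_appE)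
  from PApp.prems(2) obtain B' C' where 2: "\<Gamma> \<turnstile> M : PPi B' C'" "pconv (psubst C' 0 N) A'"
    by (rule typ_appE)
  from PApp.IH(1)[OF 1(1) 2(1)] have "pconv (psubst C 0 N) (psubst C' 0 N)"
    by (blast intro: pconv_psubst equivclp_refl dest: pconv_pi_inject)
  with 1(2) 2(2) show ?case by (meson equivclp_sym equivclp_trans)
next
  case (PLam B M)
  from PLam.prems(1) obtain C where 1: "B # \<Gamma> \<turnstile> M : C" "pconv (PPi B C) A" by (rule typ_lamE)
  from PLam.prems(2) obtain C' where 2: "B # \<Gamma> \<turnstile> M : C'" "pconv (PPi B C') A'" by (rule typ_lamE)
  from PLam.IH(2)[OF 1(1) 2(1)] have "pconv (PPi B C) (PPi B C')" by (simp add: pconv_pi)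
  with 1(2) 2(2) show ?case by (meson equivclp_sym equivclp_trans)
next
  case (PPi B C)
  from PPi.prems(1) obtain s1 s2 s3 where 1: "\<Gamma> \<turnstile> B : PSort s1" "B # \<Gamma> \<turnstile> C : PSort s2"
    "(s1, s2, s3) \<in> Rl" "pconv (PSort s3) A" by (rule typ_piE)
  from PPi.prems(2) obtain t1 t2 t3 where 2: "\<Gamma> \<turnstile> B : PSort t1" "B # \<Gamma> \<turnstile> C : PSort t2"
    "(t1, t2, t3) \<in> Rl" "pconv (PSort t3) A'" by (rule typ_piE)
  from PPi.IH(1)[OF 1(1) 2(1)] PPi.IH(2)[OF 1(2) 2(2)] have "s1 = t1" "s2 = t2"
    by (auto dest: pconv_sort_inject)
  with 1(3,4) 2(3,4) show ?case by (metis functional_Rl equivclp_sym equivclp_trans)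
qed

end

subsection \<open>Skeletons of type families\<close>

text \<open>\<open>Small s\<close> stands for what corresponds to a source type of sort
  \<open>s\<close>, \<open>Top\<close> for the universe of a sort without an axiom,
  \<open>Fn\<close> for a product without a source rule.\<close>

datatype 's skel = Small 's | Top | Fn "'s skel" "'s skel"

text \<open>Type families are recognised by their head, which is never a variable; hence a skeleton that ignores
  the arguments of a family is invariant under substitution.\<close>

primrec fam :: "'s sconst dterm \<Rightarrow> bool" where
  "fam (DSort s) \<longleftrightarrow> False"
| "fam (DVar i) \<longleftrightarrow> False"
| "fam (DConst c) \<longleftrightarrow> (\<exists>s. c = U s \<or> c = Eps s)"
| "fam (DApp M N) \<longleftrightarrow> fam M"
| "fam (DLam A M) \<longleftrightarrow> fam M"
| "fam (DPi A B) \<longleftrightarrow> fam A \<and> fam B"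

primrec kind :: "'s sconst dterm \<Rightarrow> bool" where
  "kind (DSort s) \<longleftrightarrow> s = Type"
| "kind (DVar i) \<longleftrightarrow> False"
| "kind (DConst c) \<longleftrightarrow> False"
| "kind (DApp M N) \<longleftrightarrow> False"
| "kind (DLam A M) \<longleftrightarrow> False"
| "kind (DPi A B) \<longleftrightarrow> fam A \<and> kind B"

lemma fam_not_kind: "fam M \<Longrightarrow> \<not> kind M"
  by (induction M) auto

lemma fam_dinst: "fam M \<Longrightarrow> fam (dinst \<sigma> M)"
  by (induction M arbitrary: \<sigma>) auto

lemma kind_dinst: "kind M \<Longrightarrow> kind (dinst \<sigma> M)"
  by (induction M arbitrary: \<sigma>) (auto intro: fam_dinst)

lemma fam_dlifts: "fam M \<Longrightarrow> fam ((dlift 0 ^^ n) M)"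
  by (induction n) (simp_all add: dlift_0 dren_eq_dinst fam_dinst)

lemma fam_dstep: "dstep (rwS Ax Rl) M N \<Longrightarrow> fam M \<Longrightarrow> fam N"
  by (induction rule: dstep.induct) (auto simp: dsubst_0 fam_dinst elim: rwS.cases)

lemma kind_dstep: "dstep (rwS Ax Rl) M N \<Longrightarrow> kind M \<Longrightarrow> kind N"
  by (induction rule: dstep.induct) (auto elim: rwS.cases fam_dstep)

lemma fam_dsteps: "(dstep (rwS Ax Rl))\<^sup>*\<^sup>* M N \<Longrightarrow> fam M \<Longrightarrow> fam N"
  by (induction rule: rtranclp_induct) (auto intro: fam_dstep)

lemma kind_dsteps: "(dstep (rwS Ax Rl))\<^sup>*\<^sup>* M N \<Longrightarrow> kind M \<Longrightarrow> kind N"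
  by (induction rule: rtranclp_induct) (auto intro: kind_dstep)

lemma Kind_dsteps: "(dstep (rwS Ax Rl))\<^sup>*\<^sup>* (DSort Kind) N \<Longrightarrow> N = DSort Kind"
  by (induction rule: rtranclp_induct) (auto elim: dstep.cases rwS.cases)

text \<open>\<open>fam\<close> and \<open>kind\<close> survive reduction but not expansion (an
  identity function applied to \<open>U s\<close> is not \<open>fam\<close>), so conversion is
  treated through a common reduct.\<close>

lemma fam_kind_not_dconv: "dconv (rwS Ax Rl) M N \<Longrightarrow> fam M \<Longrightarrow> \<not> kind N"
  by (metis dconv_joinable fam_dsteps kind_dsteps fam_not_kind)

lemma Kind_not_dconv: "dconv (rwS Ax Rl) (DSort Kind) N \<Longrightarrow> \<not> fam N \<and> \<not> kind N"
  by (metis dconv_joinable fam_dsteps kind_dsteps Kind_dsteps fam.simps(1) kind.simps(1) lpsort.distinct(1))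

context functional_pts
begin

text \<open>\<open>rw_sort\<close> identifies \<open>U s\<close> with \<open>Eps t\<close> applied
  to \<open>Dot s\<close>, so an axiom for \<open>s\<close> must give its universe the skeleton of
  \<open>Eps t\<close>.\<close>

definition sort_skel :: "'s \<Rightarrow> 's skel" where
  "sort_skel s = (if \<exists>t. (s, t) \<in> Ax then Small (THE t. (s, t) \<in> Ax) else Top)"

text \<open>The collapse is forced by \<open>rw_pi\<close>: a product formed by a rule is
  convertible to an application of \<open>Eps s3\<close>, whose skeleton is \<open>Small s3\<close>.
  Functionality makes \<open>s3\<close> unique.\<close>

definition pi_skel :: "'s skel \<Rightarrow> 's skel \<Rightarrow> 's skel" where
  "pi_skel k l = (if \<exists>s1 s2 s3. k = Small s1 \<and> l = Small s2 \<and> (s1, s2, s3) \<in> Rl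
     then Small (THE s3. \<exists>s1 s2. k = Small s1 \<and> l = Small s2 \<and> (s1, s2, s3) \<in> Rl) else Fn k l)"

lemma sort_skel_Ax: "(s, t) \<in> Ax \<Longrightarrow> sort_skel s = Small t"
  unfolding sort_skel_def by (auto intro: functional_Ax)

lemma sort_skel_cases:
  obtains (Small) t where "(s, t) \<in> Ax" "sort_skel s = Small t" | (Top) "sort_skel s = Top"
proof (cases "\<exists>t. (s, t) \<in> Ax")
  case True
  then show ?thesis using that(1) sort_skel_Ax by blast
next
  case False
  then show ?thesis using that(2) by (simp add: sort_skel_def)
qed

lemma pi_skel_Rl: "(s1, s2, s3) \<in> Rl \<Longrightarrow> pi_skel (Small s1) (Small s2) = Small s3"
  unfolding pi_skel_def by (auto intro: functional_Rl)

lemma pi_skel_cases: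
  obtains (Small) s1 s2 s3 where "k = Small s1" "l = Small s2" "(s1, s2, s3) \<in> Rl"
    "pi_skel k l = Small s3"
  | (Fn) "pi_skel k l = Fn k l"
proof (cases "\<exists>s1 s2 s3. k = Small s1 \<and> l = Small s2 \<and> (s1, s2, s3) \<in> Rl")
  case True
  then show ?thesis using that(1) pi_skel_Rl by blast
next
  case False
  then show ?thesis using that(2) unfolding pi_skel_def by (simp only: if_False)
qed

text \<open>Outside \<open>fam\<close> the value \<open>Top\<close> is a dummy; on families it
  arises only through \<open>sort_skel\<close>.\<close>

primrec skel :: "'s sconst dterm \<Rightarrow> 's skel" where
  "skel (DSort s) = Top"
| "skel (DVar i) = Top"
| "skel (DConst c) = (case c of U s \<Rightarrow> sort_skel s | Eps s \<Rightarrow> Small s | _ \<Rightarrow> Top)"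
| "skel (DApp M N) = skel M"
| "skel (DLam A M) = skel M"
| "skel (DPi A B) = pi_skel (skel A) (skel B)"

primrec kskel :: "'s sconst dterm \<Rightarrow> 's skel list" where
  "kskel (DSort s) = []"
| "kskel (DVar i) = []"
| "kskel (DConst c) = []"
| "kskel (DApp M N) = []"
| "kskel (DLam A M) = []"
| "kskel (DPi A B) = skel A # kskel B"

lemma skel_dinst: "fam M \<Longrightarrow> skel (dinst \<sigma> M) = skel M"
  by (induction M arbitrary: \<sigma>) auto

lemma kskel_dinst: "kind M \<Longrightarrow> kskel (dinst \<sigma> M) = kskel M"
  by (induction M arbitrary: \<sigma>) (auto simp: skel_dinst)

lemma skel_dlifts: "fam M \<Longrightarrow> skel ((dlift 0 ^^ n) M) = skel M"
  by (induction n) (simp_all add: dlift_0 dren_eq_dinst skel_dinst fam_dlifts)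

lemma skel_dstep: "dstep (rwS Ax Rl) M N \<Longrightarrow> fam M \<Longrightarrow> skel N = skel M"
proof (induction rule: dstep.induct)
  case (rew M N)
  then show ?case by cases (simp_all add: sort_skel_Ax pi_skel_Rl)
qed (auto simp: dsubst_0 skel_dinst)

lemma kskel_dstep: "dstep (rwS Ax Rl) M N \<Longrightarrow> kind M \<Longrightarrow> kskel N = kskel M"
  by (induction rule: dstep.induct) (auto simp: skel_dstep elim: rwS.cases)

lemma skel_dsteps: "(dstep (rwS Ax Rl))\<^sup>*\<^sup>* M N \<Longrightarrow> fam M \<Longrightarrow> skel N = skel M"
  by (induction rule: rtranclp_induct) (auto dest: fam_dsteps skel_dstep)

lemma kskel_dsteps: "(dstep (rwS Ax Rl))\<^sup>*\<^sup>* M N \<Longrightarrow> kind M \<Longrightarrow> kskel N = kskel M"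
  by (induction rule: rtranclp_induct) (auto dest: kind_dsteps kskel_dstep)

lemma skel_dconv: "dconv (rwS Ax Rl) M N \<Longrightarrow> fam M \<Longrightarrow> fam N \<Longrightarrow> skel M = skel N"
  by (metis dconv_joinable skel_dsteps)

lemma kskel_dconv: "dconv (rwS Ax Rl) M N \<Longrightarrow> kind M \<Longrightarrow> kind N \<Longrightarrow> kskel M = kskel N"
  by (metis dconv_joinable kskel_dsteps)

end

subsection \<open>The untyped inverse translation\<close>

definition eps_term :: "'s \<Rightarrow> 's pterm" where
  "eps_term s = PLam (PSort s) (PVar 0)"

text \<open>The two occurrences of \<open>PVar (Suc 0)\<close> denote different variables: the first
  is the domain; the second stands under the product binder and is the family. The annotations
  follow the declared type of \<open>PiC\<close>, so that the abstractions can be shown reducible at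
  that type.\<close>

definition pi_term :: "'s \<Rightarrow> 's \<Rightarrow> 's pterm" where
  "pi_term s1 s2 = PLam (PSort s1) (PLam (PPi (PVar 0) (PSort s2))
     (PPi (PVar (Suc 0)) (PApp (PVar (Suc 0)) (PVar 0))))"

text \<open>The sorts of the framework never matter; they are sent to an arbitrary sort.\<close>

primrec inv_tr :: "'s sconst dterm \<Rightarrow> 's pterm" where
  "inv_tr (DSort s) = PSort undefined"
| "inv_tr (DVar i) = PVar i"
| "inv_tr (DConst c) = (case c of U s \<Rightarrow> PSort s | Eps s \<Rightarrow> eps_term s | Dot s \<Rightarrow> PSort s
    | PiC s1 s2 s3 \<Rightarrow> pi_term s1 s2)"
| "inv_tr (DApp M N) = PApp (inv_tr M) (inv_tr N)"
| "inv_tr (DLam A M) = PLam (inv_tr A) (inv_tr M)"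
| "inv_tr (DPi A B) = PPi (inv_tr A) (inv_tr B)"

lemma inv_tr_dlift: "inv_tr (dlift k M) = plift k (inv_tr M)"
  by (induction M arbitrary: k) (auto simp: eps_term_def pi_term_def split: sconst.split)

lemma inv_tr_dsubst: "inv_tr (dsubst M k N) = psubst (inv_tr M) k (inv_tr N)"
  by (induction M arbitrary: k N) (auto simp: eps_term_def pi_term_def inv_tr_dlift split: sconst.split)

lemma inv_tr_dlifts: "inv_tr ((dlift 0 ^^ n) M) = (plift 0 ^^ n) (inv_tr M)"
  by (induction n) (simp_all add: inv_tr_dlift)

lemma psubst_pren_Suc: "psubst (pren Suc M) 0 N = M"
  by (simp add: psubst_0 pinst_pren)

lemma eps_term_pconv: "pconv (PApp (eps_term s) M) M"
  using pconv_beta[of "PSort s" "PVar 0" M] by (simp add: eps_term_def)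

lemma pi_term_pconv:
  "pconv (PApp (PApp (pi_term s1 s2) A) B) (PPi A (PApp (pren Suc B) (PVar 0)))"
proof -
  let ?P = "PLam (PPi A (PSort s2)) (PPi (pren Suc A) (PApp (PVar (Suc 0)) (PVar 0)))"
  have "pconv (PApp (pi_term s1 s2) A) ?P"
    using pconv_beta[of "PSort s1" "PLam (PPi (PVar 0) (PSort s2))
      (PPi (PVar (Suc 0)) (PApp (PVar (Suc 0)) (PVar 0)))" A]
    by (simp add: pi_term_def plift_0)
  then have "pconv (PApp (PApp (pi_term s1 s2) A) B) (PApp ?P B)"
    by (simp add: pconv_app)
  also have "pconv (PApp ?P B) (PPi A (PApp (pren Suc B) (PVar 0)))"
    using pconv_beta[of "PPi A (PSort s2)" "PPi (pren Suc A) (PApp (PVar (Suc 0)) (PVar 0))" B]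
    by (simp add: psubst_pren_Suc plift_0)
  finally show ?thesis .
qed

lemma inv_tr_rwS: "rwS Ax Rl M N \<Longrightarrow> pconv (inv_tr M) (inv_tr N)"
proof (induction rule: rwS.induct)
  case (rw_sort s1 s2)
  show ?case by (simp add: eps_term_pconv)
next
  case (rw_pi s1 s2 s3 A B)
  have "pconv (PApp (eps_term s3) (PApp (PApp (pi_term s1 s2) (inv_tr A)) (inv_tr B)))
      (PPi (inv_tr A) (PApp (pren Suc (inv_tr B)) (PVar 0)))"
    using eps_term_pconv pi_term_pconv by (rule equivclp_trans)
  also have "pconv \<dots> (PPi (PApp (eps_term s1) (inv_tr A))
      (PApp (eps_term s2) (PApp (pren Suc (inv_tr B)) (PVar 0))))"
    by (intro pconv_pi equivclp_sym[OF eps_term_pconv])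
  finally show ?case by (simp add: inv_tr_dlift plift_0)
qed

lemma inv_tr_dstep: "dstep (rwS Ax Rl) M N \<Longrightarrow> pconv (inv_tr M) (inv_tr N)"
  by (induction rule: dstep.induct)
    (simp_all add: inv_tr_rwS inv_tr_dsubst pconv_beta pconv_app pconv_lam pconv_pi)

lemma inv_tr_dconv: "dconv (rwS Ax Rl) M N \<Longrightarrow> pconv (inv_tr M) (inv_tr N)"
  by (erule equivclp_map) (rule inv_tr_dstep)

subsection \<open>Reducibility\<close>

context functional_pts
begin

text \<open>Typed representatives are needed for both the type and the term: the inverse translation
  leaves redexes, such as \<open>eps_term s\<close> applied to a type, that the source need not be
  able to type.\<close>

definition base_red :: "'s pterm list \<Rightarrow> 's pterm \<Rightarrow> 's pterm \<Rightarrow> bool" where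
  "base_red \<Delta> A M \<longleftrightarrow> (\<exists>A' M'. pconv A A' \<and> pconv M M' \<and> (\<Delta> \<turnstile> M' : A'))"

text \<open>Types that correspond to types of the source system are interpreted by typability in the source
  system, whether or not they are products; only the remaining products get a function space.\<close>

primrec red :: "'s skel \<Rightarrow> 's pterm list \<Rightarrow> 's pterm \<Rightarrow> 's pterm \<Rightarrow> bool" where
  "red (Small s) \<Delta> A M \<longleftrightarrow> base_red \<Delta> A M"
| "red Top \<Delta> A M \<longleftrightarrow> base_red \<Delta> A M"
| "red (Fn k l) \<Delta> A M \<longleftrightarrow> (\<exists>B C. pconv A (PPi B C) \<and>
     (\<forall>\<xi> \<Delta>' N. ren_ok \<Delta> \<xi> \<Delta>' \<longrightarrow> red k \<Delta>' (pren \<xi> B) N \<longrightarrow>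
        red l \<Delta>' (pinst (N \<cdot> (PVar \<circ> \<xi>)) C) (PApp (pren \<xi> M) N)))"

text \<open>A typable representative is demanded only of \<open>Small\<close> types, as only these
  become components of a source product or entries of a source context.\<close>

fun tred :: "'s skel \<Rightarrow> 's pterm list \<Rightarrow> 's pterm \<Rightarrow> bool" where
  "tred (Small s) \<Delta> A \<longleftrightarrow> (\<exists>A'. pconv A A' \<and> (\<Delta> \<turnstile> A' : PSort s))"
| "tred _ \<Delta> A \<longleftrightarrow> True"

text \<open>The kind \<open>K\<close> is carried along to supply the domains at which a family is
  tested, as the type does in \<open>red\<close>.\<close>

primrec fred :: "'s skel list \<Rightarrow> 's skel \<Rightarrow> 's pterm list \<Rightarrow> 's pterm \<Rightarrow> 's pterm \<Rightarrow> bool" where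
  "fred [] l \<Delta> K M \<longleftrightarrow> tred l \<Delta> M"
| "fred (k # ks) l \<Delta> K M \<longleftrightarrow> (\<exists>B C. pconv K (PPi B C) \<and>
     (\<forall>\<xi> \<Delta>' N. ren_ok \<Delta> \<xi> \<Delta>' \<longrightarrow> red k \<Delta>' (pren \<xi> B) N \<longrightarrow>
        fred ks l \<Delta>' (pinst (N \<cdot> (PVar \<circ> \<xi>)) C) (PApp (pren \<xi> M) N)))"

lemma base_red_conv: "base_red \<Delta> A M \<Longrightarrow> pconv A A' \<Longrightarrow> pconv M M' \<Longrightarrow> base_red \<Delta> A' M'"
  unfolding base_red_def by (meson equivclp_sym equivclp_trans)

lemma red_conv: "red k \<Delta> A M \<Longrightarrow> pconv A A' \<Longrightarrow> pconv M M' \<Longrightarrow> red k \<Delta> A' M'"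
proof (induction k arbitrary: \<Delta> A M A' M')
  case (Fn k l)
  from Fn.prems(1) obtain B C where BC: "pconv A (PPi B C)"
    and *: "\<And>\<xi> \<Delta>' N. ren_ok \<Delta> \<xi> \<Delta>' \<Longrightarrow> red k \<Delta>' (pren \<xi> B) N \<Longrightarrow>
      red l \<Delta>' (pinst (N \<cdot> (PVar \<circ> \<xi>)) C) (PApp (pren \<xi> M) N)"
    by auto
  have "red l \<Delta>' (pinst (N \<cdot> (PVar \<circ> \<xi>)) C) (PApp (pren \<xi> M') N)"
    if "ren_ok \<Delta> \<xi> \<Delta>'" "red k \<Delta>' (pren \<xi> B) N" for \<xi> \<Delta>' N
    using *[OF that] by (rule Fn.IH(2)) (simp_all add: pconv_app pconv_pren Fn.prems)
  moreover have "pconv A' (PPi B C)" using BC Fn.prems(2) by (meson equivclp_sym equivclp_trans)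
  ultimately show ?case unfolding red.simps by blast
qed (auto intro: base_red_conv)

lemma tred_conv: "tred k \<Delta> A \<Longrightarrow> pconv A A' \<Longrightarrow> tred k \<Delta> A'"
  by (cases k) (auto intro: equivclp_sym equivclp_trans)

lemma fred_conv: "fred ks l \<Delta> K M \<Longrightarrow> pconv K K' \<Longrightarrow> pconv M M' \<Longrightarrow> fred ks l \<Delta> K' M'"
proof (induction ks arbitrary: \<Delta> K M K' M')
  case Nil
  then show ?case by (auto intro: tred_conv)
next
  case (Cons k ks)
  from Cons.prems(1) obtain B C where BC: "pconv K (PPi B C)"
    and *: "\<And>\<xi> \<Delta>' N. ren_ok \<Delta> \<xi> \<Delta>' \<Longrightarrow> red k \<Delta>' (pren \<xi> B) N \<Longrightarrow>
      fred ks l \<Delta>' (pinst (N \<cdot> (PVar \<circ> \<xi>)) C) (PApp (pren \<xi> M) N)"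
    by auto
  have "fred ks l \<Delta>' (pinst (N \<cdot> (PVar \<circ> \<xi>)) C) (PApp (pren \<xi> M') N)"
    if "ren_ok \<Delta> \<xi> \<Delta>'" "red k \<Delta>' (pren \<xi> B) N" for \<xi> \<Delta>' N
    using *[OF that] by (rule Cons.IH) (simp_all add: pconv_app pconv_pren Cons.prems)
  moreover have "pconv K' (PPi B C)" using BC Cons.prems(2) by (meson equivclp_sym equivclp_trans)
  ultimately show ?case unfolding fred.simps by blast
qed

lemma pinst_scons_pren_up:
  "pinst (N \<cdot> (PVar \<circ> \<zeta>)) (pren (ren_up \<xi>) C) = pinst (N \<cdot> (PVar \<circ> (\<zeta> \<circ> \<xi>))) C"
  unfolding pinst_pren
  by (rule arg_cong[where f = "\<lambda>\<sigma>. pinst \<sigma> C"], rule ext, rename_tac i, case_tac i) simp_all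

text \<open>Monotonicity in the world. A case distinction replaces induction on \<open>k\<close>,
  since the function space already quantifies over all later worlds and renamings compose.\<close>

lemma red_pren:
  assumes "red k \<Delta> A M" and \<xi>: "ren_ok \<Delta> \<xi> \<Delta>'"
  shows "red k \<Delta>' (pren \<xi> A) (pren \<xi> M)"
proof -
  have base: "base_red \<Delta>' (pren \<xi> A) (pren \<xi> M)" if "base_red \<Delta> A M"
    using that \<xi> unfolding base_red_def by (blast intro: pconv_pren typ_pren)
  show ?thesis
  proof (cases k)
    case (Fn k l)
    with assms(1) obtain B C where BC: "pconv A (PPi B C)"
      and *: "\<And>\<xi> \<Delta>' N. ren_ok \<Delta> \<xi> \<Delta>' \<Longrightarrow> red k \<Delta>' (pren \<xi> B) N \<Longrightarrow>
        red l \<Delta>' (pinst (N \<cdot> (PVar \<circ> \<xi>)) C) (PApp (pren \<xi> M) N)"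
      by auto
    have "pconv (pren \<xi> A) (PPi (pren \<xi> B) (pren (ren_up \<xi>) C))"
      using pconv_pren[OF BC] by simp
    moreover have "red l \<Delta>'' (pinst (N \<cdot> (PVar \<circ> \<zeta>)) (pren (ren_up \<xi>) C)) (PApp (pren \<zeta> (pren \<xi> M)) N)"
      if "ren_ok \<Delta>' \<zeta> \<Delta>''" "red k \<Delta>'' (pren \<zeta> (pren \<xi> B)) N" for \<zeta> \<Delta>'' N
      using *[OF ren_ok_comp[OF \<xi> that(1)]] that(2) by (simp add: pren_pren pinst_scons_pren_up)
    ultimately show ?thesis unfolding Fn red.simps by blast
  qed (use assms base in auto)
qed

lemma base_red_sortD:
  assumes "base_red \<Delta> (PSort s) M" obtains M' where "pconv M M'" "\<Delta> \<turnstile> M' : PSort s"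
  using assms unfolding base_red_def by (meson typ_conv_sort equivclp_sym)

text \<open>Both possible skeletons of a universe mean typability, and the representative of the
  type can be the sort itself because whatever is convertible to a sort reduces to it.\<close>

lemma red_sort: "red (sort_skel s) \<Delta> (PSort s) M \<longleftrightarrow> (\<exists>M'. pconv M M' \<and> (\<Delta> \<turnstile> M' : PSort s))"
proof -
  have "red (sort_skel s) \<Delta> (PSort s) M \<longleftrightarrow> base_red \<Delta> (PSort s) M"
    by (rule sort_skel_cases[of s]) simp_all
  also have "\<dots> \<longleftrightarrow> (\<exists>M'. pconv M M' \<and> (\<Delta> \<turnstile> M' : PSort s))"
    by (meson base_red_sortD base_red_def equivclp_refl)
  finally show ?thesis .
qed

lemma tred_sort: "pwf \<Delta> \<Longrightarrow> tred (sort_skel s) \<Delta> (PSort s)"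
  by (rule sort_skel_cases[of s]) (auto intro: ptyp_sort equivclp_refl)

lemma PVar_scons_Suc [simp]: "PVar 0 \<cdot> (PVar \<circ> Suc) = PVar"
  by (rule scons_eta[symmetric])

text \<open>The context can only be extended by the typable representative \<open>A'\<close>, while
  reducibility is wanted at the original \<open>A\<close>; conversion bridges the two.\<close>

lemma red_var_0:
  assumes "pconv A A'" "\<Delta> \<turnstile> A' : PSort s"
  shows "red (Small t) (A' # \<Delta>) (pren Suc A) (PVar 0)"
  using pconv_pren[OF assms(1), of Suc] typ_var_0[OF assms(2)]
  by (auto simp: base_red_def intro: equivclp_refl)

section \<open>Reducibility of products, abstractions and applications\<close>

text \<open>When a rule applies, the codomain is evaluated at a fresh variable, which makes it
  typable over the representative of the domain. Otherwise nothing has to be typed.\<close>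

lemma red_PPi:
  assumes "tred k \<Delta> A"
    and B: "\<And>\<xi> \<Delta>' N. ren_ok \<Delta> \<xi> \<Delta>' \<Longrightarrow> red k \<Delta>' (pren \<xi> A) N \<Longrightarrow>
      tred l \<Delta>' (pinst (N \<cdot> (PVar \<circ> \<xi>)) B)"
  shows "tred (pi_skel k l) \<Delta> (PPi A B)"
proof (cases k l rule: pi_skel_cases)
  case (Small s1 s2 s3)
  with assms(1) obtain A' where A': "pconv A A'" "\<Delta> \<turnstile> A' : PSort s1" by auto
  from B[OF ren_ok_Suc[OF A'(2)], of "PVar 0"] red_var_0[OF A'] Small have "tred l (A' # \<Delta>) B" by simp
  with Small obtain B' where "pconv B B'" "A' # \<Delta> \<turnstile> B' : PSort s2" by auto
  with A' Small(3) have "pconv (PPi A B) (PPi A' B') \<and> (\<Delta> \<turnstile> PPi A' B' : PSort s3)"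
    by (blast intro: pconv_pi ptyp_pi)
  with Small(4) show ?thesis by auto
qed simp

text \<open>When a rule applies, the body is evaluated at a fresh variable and abstracted again
  inside the source. Otherwise the function space only has to be closed under beta
  expansion.\<close>

lemma red_PLam:
  assumes "tred (pi_skel k l) \<Delta> (PPi A B)"
    and M: "\<And>\<xi> \<Delta>' N. ren_ok \<Delta> \<xi> \<Delta>' \<Longrightarrow> red k \<Delta>' (pren \<xi> A) N \<Longrightarrow>
      red l \<Delta>' (pinst (N \<cdot> (PVar \<circ> \<xi>)) B) (pinst (N \<cdot> (PVar \<circ> \<xi>)) M)"
  shows "red (pi_skel k l) \<Delta> (PPi A B) (PLam A M)"
proof (cases k l rule: pi_skel_cases)
  case (Small s1 s2 s3)
  \<comment> \<open>Only some \<open>C\<close> convertible to the product is known to be typable. It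
    reduces to a product of the same sort, which provides the annotation and the codomain of the
    source abstraction.\<close>
  with assms(1) obtain C where "pconv C (PPi A B)" "\<Delta> \<turnstile> C : PSort s3" by (auto intro: equivclp_sym)
  then obtain A' B' where AB: "pconv A A'" "pconv B B'" and pi: "\<Delta> \<turnstile> PPi A' B' : PSort s3"
    by (meson pconv_pi_reduct subject_reduction)
  from pi obtain t1 t2 where t: "\<Delta> \<turnstile> A' : PSort t1" "A' # \<Delta> \<turnstile> B' : PSort t2" by (rule typ_piE)
  from M[OF ren_ok_Suc[OF t(1)], of "PVar 0"] red_var_0[OF AB(1) t(1)] Small have "base_red (A' # \<Delta>) B M"
    by simp
  then obtain B'' M' where M': "pconv B B''" "pconv M M'" "A' # \<Delta> \<turnstile> M' : B''"
    unfolding base_red_def by blast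
  have "pconv B'' B'" using M'(1) AB(2) by (meson equivclp_sym equivclp_trans)
  with M'(3) t(2) have "A' # \<Delta> \<turnstile> M' : B'" by (rule ptyp_conv)
  then have "\<Delta> \<turnstile> PLam A' M' : PPi A' B'" using pi by (rule ptyp_lam)
  with AB M'(2) have "base_red \<Delta> (PPi A B) (PLam A M)"
    unfolding base_red_def by (blast intro: pconv_pi pconv_lam)
  with Small show ?thesis by simp
next
  case Fn
  have "red l \<Delta>' (pinst (N \<cdot> (PVar \<circ> \<xi>)) B) (PApp (pren \<xi> (PLam A M)) N)"
    if "ren_ok \<Delta> \<xi> \<Delta>'" "red k \<Delta>' (pren \<xi> A) N" for \<xi> \<Delta>' N
  proof (rule red_conv[OF M[OF that] equivclp_refl], rule equivclp_sym)
    show "pconv (PApp (pren \<xi> (PLam A M)) N) (pinst (N \<cdot> (PVar \<circ> \<xi>)) M)"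
      using pconv_beta[of "pren \<xi> A" "pren (ren_up \<xi>) M" N]
      by (simp add: psubst_0 pinst_scons_pren_up[of N id, simplified])
  qed
  then show ?thesis unfolding Fn red.simps by (blast intro: equivclp_refl)
qed

text \<open>In the function space case the domain named by the relation is only convertible to
  \<open>A\<close>; injectivity of products moves the argument there, and the identity renaming
  keeps the current world.\<close>

lemma red_PApp:
  assumes M: "red (pi_skel k l) \<Delta> (PPi A B) M" and N: "red k \<Delta> A N" and "pwf \<Delta>"
  shows "red l \<Delta> (psubst B 0 N) (PApp M N)"
proof (cases k l rule: pi_skel_cases)
  case (Small s1 s2 s3)
  with M obtain C M' where "pconv (PPi A B) C" and M': "pconv M M'" and "\<Delta> \<turnstile> M' : C"
    unfolding base_red_def by (auto simp: base_red_def)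
  then obtain A' B' where pi: "\<Delta> \<turnstile> M' : PPi A' B'" and AB: "pconv A A'" "pconv B B'"
    by (meson typ_conv_pi equivclp_sym)
  from pi obtain t1 where t: "\<Delta> \<turnstile> A' : PSort t1" by (rule typ_pi_typ)
  from N Small obtain A'' N' where N': "pconv A A''" "pconv N N'" "\<Delta> \<turnstile> N' : A''"
    by (auto simp: base_red_def)
  have "pconv A'' A'" using N'(1) AB(1) by (meson equivclp_sym equivclp_trans)
  with N'(3) t have "\<Delta> \<turnstile> N' : A'" by (rule ptyp_conv)
  with pi have "\<Delta> \<turnstile> PApp M' N' : psubst B' 0 N'" by (rule ptyp_app)
  then have "base_red \<Delta> (psubst B 0 N) (PApp M N)"
    unfolding base_red_def using AB M' N' by (blast intro: pconv_psubst pconv_app)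
  with Small show ?thesis by simp
next
  case Fn
  with M obtain B' C' where pi: "pconv (PPi A B) (PPi B' C')"
    and *: "\<And>\<xi> \<Delta>' N. ren_ok \<Delta> \<xi> \<Delta>' \<Longrightarrow> red k \<Delta>' (pren \<xi> B') N \<Longrightarrow>
        red l \<Delta>' (pinst (N \<cdot> (PVar \<circ> \<xi>)) C') (PApp (pren \<xi> M) N)"
    by auto
  from pi have c: "pconv A B'" "pconv B C'" by (blast dest: pconv_pi_inject)+
  from *[OF ren_ok_id[OF assms(3)]] red_conv[OF N c(1) equivclp_refl]
  have "red l \<Delta> (psubst C' 0 N) (PApp M N)" by (simp add: psubst_0)
  then show ?thesis
    by (rule red_conv) (use c(2) in \<open>blast intro: pconv_psubst equivclp_refl equivclp_sym\<close>)+
qed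

lemma fred_PLam:
  assumes M: "\<And>\<xi> \<Delta>' N. ren_ok \<Delta> \<xi> \<Delta>' \<Longrightarrow> red k \<Delta>' (pren \<xi> A) N \<Longrightarrow>
      fred ks l \<Delta>' (pinst (N \<cdot> (PVar \<circ> \<xi>)) K) (pinst (N \<cdot> (PVar \<circ> \<xi>)) M)"
  shows "fred (k # ks) l \<Delta> (PPi A K) (PLam A M)"
proof -
  have "fred ks l \<Delta>' (pinst (N \<cdot> (PVar \<circ> \<xi>)) K) (PApp (pren \<xi> (PLam A M)) N)"
    if "ren_ok \<Delta> \<xi> \<Delta>'" "red k \<Delta>' (pren \<xi> A) N" for \<xi> \<Delta>' N
  proof (rule fred_conv[OF M[OF that] equivclp_refl], rule equivclp_sym)
    show "pconv (PApp (pren \<xi> (PLam A M)) N) (pinst (N \<cdot> (PVar \<circ> \<xi>)) M)"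
      using pconv_beta[of "pren \<xi> A" "pren (ren_up \<xi>) M" N]
      by (simp add: psubst_0 pinst_scons_pren_up[of N id, simplified])
  qed
  then show ?thesis unfolding fred.simps by (blast intro: equivclp_refl)
qed

lemma fred_PApp:
  assumes M: "fred (k # ks) l \<Delta> (PPi A K) M" and N: "red k \<Delta> A N" and "pwf \<Delta>"
  shows "fred ks l \<Delta> (psubst K 0 N) (PApp M N)"
proof -
  from M obtain B' C' where pi: "pconv (PPi A K) (PPi B' C')"
    and *: "\<And>\<xi> \<Delta>' N. ren_ok \<Delta> \<xi> \<Delta>' \<Longrightarrow> red k \<Delta>' (pren \<xi> B') N \<Longrightarrow>
        fred ks l \<Delta>' (pinst (N \<cdot> (PVar \<circ> \<xi>)) C') (PApp (pren \<xi> M) N)"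
    by auto
  from pi have c: "pconv A B'" "pconv K C'" by (blast dest: pconv_pi_inject)+
  from *[OF ren_ok_id[OF assms(3)]] red_conv[OF N c(1) equivclp_refl]
  have "fred ks l \<Delta> (psubst C' 0 N) (PApp M N)" by (simp add: psubst_0)
  then show ?thesis
    by (rule fred_conv) (use c(2) in \<open>blast intro: pconv_psubst equivclp_refl equivclp_sym\<close>)+
qed

section \<open>Reducibility of the images of the constants\<close>

text \<open>Up to conversion, the elements of the universe of \<open>s\<close> are the source terms
  of type \<open>s\<close>, which is exactly what a reducible type with skeleton
  \<open>Small s\<close> is.\<close>

lemma red_eps_term: "fred [sort_skel s] (Small s) \<Delta> (PPi (PSort s) K) (eps_term s)"
  unfolding eps_term_def
proof (rule fred_PLam)
  fix \<xi> \<Delta>' N assume "red (sort_skel s) \<Delta>' (pren \<xi> (PSort s)) N"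
  then show "fred [] (Small s) \<Delta>' (pinst (N \<cdot> (PVar \<circ> \<xi>)) K) (pinst (N \<cdot> (PVar \<circ> \<xi>)) (PVar 0))"
    by (simp add: red_sort)
qed

text \<open>The three products in the type of the constant may or may not have source rules; the
  lemmas on \<open>pi_skel\<close> treat all cases uniformly. The rule \<open>(s1, s2, s3)\<close>
  enters once, to form the resulting product after the family has been tested at a fresh
  variable.\<close>

lemma red_pi_term:
  assumes Rl: "(s1, s2, s3) \<in> Rl" and "pwf \<Delta>"
  shows "red (pi_skel (sort_skel s1) (pi_skel (pi_skel (Small s1) (sort_skel s2)) (sort_skel s3))) \<Delta>
    (PPi (PSort s1) (PPi (PPi (PVar 0) (PSort s2)) (PSort s3))) (pi_term s1 s2)"
proof -
  let ?k = "pi_skel (Small s1) (sort_skel s2)"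
  have ty: "tred (pi_skel ?k (sort_skel s3)) \<Delta> (PPi (PPi A (PSort s2)) (PSort s3))"
    and tm: "red (pi_skel ?k (sort_skel s3)) \<Delta> (PPi (PPi A (PSort s2)) (PSort s3))
      (PLam (PPi A (PSort s2)) (PPi (pren Suc A) (PApp (PVar (Suc 0)) (PVar 0))))"
    if "red (sort_skel s1) \<Delta> (PSort s1) A" for \<Delta> A
  proof -
    from that obtain A' where A': "pconv A A'" "\<Delta> \<turnstile> A' : PSort s1" by (auto simp: red_sort)
    have k: "tred ?k \<Delta> (PPi A (PSort s2))"
      using A' by (intro red_PPi) (auto simp: ren_ok_def intro: tred_sort)
    show ty: "tred (pi_skel ?k (sort_skel s3)) \<Delta> (PPi (PPi A (PSort s2)) (PSort s3))"
      by (rule red_PPi[OF k]) (auto simp: ren_ok_def intro: tred_sort)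
    show "red (pi_skel ?k (sort_skel s3)) \<Delta> (PPi (PPi A (PSort s2)) (PSort s3))
      (PLam (PPi A (PSort s2)) (PPi (pren Suc A) (PApp (PVar (Suc 0)) (PVar 0))))"
    proof (rule red_PLam[OF ty])
      fix \<xi> \<Delta>' B
      assume \<xi>: "ren_ok \<Delta> \<xi> \<Delta>'" and B: "red ?k \<Delta>' (pren \<xi> (PPi A (PSort s2))) B"
      let ?A = "pren \<xi> A'"
      have A: "pconv (pren \<xi> A) ?A" "\<Delta>' \<turnstile> ?A : PSort s1"
        using A' typ_pren[OF A'(2) \<xi>] by (auto intro: pconv_pren)
      \<comment> \<open>The family is weakened so that it can be applied to the fresh variable of
        type \<open>?A\<close>.\<close>
      have "red ?k (?A # \<Delta>') (PPi (pren Suc (pren \<xi> A)) (PSort s2)) (pren Suc B)"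
        using red_pren[OF B ren_ok_Suc[OF A(2)]] by simp
      from red_PApp[OF this red_var_0[OF A]]
      obtain B' where "pconv (PApp (pren Suc B) (PVar 0)) B'" "?A # \<Delta>' \<turnstile> B' : PSort s2"
        using A(2) by (auto simp: red_sort intro: pwf_Cons)
      with A Rl have "\<exists>M'. pconv (PPi (pren \<xi> A) (PApp (pren Suc B) (PVar 0))) M' \<and>
          (\<Delta>' \<turnstile> M' : PSort s3)"
        by (blast intro: pconv_pi ptyp_pi)
      moreover have "pinst (B \<cdot> (PVar \<circ> \<xi>)) (pren Suc A) = pren \<xi> A"
        by (simp only: pinst_scons_pren_Suc pren_eq_pinst[of \<xi>])
      ultimately show "red (sort_skel s3) \<Delta>' (pinst (B \<cdot> (PVar \<circ> \<xi>)) (PSort s3))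
          (pinst (B \<cdot> (PVar \<circ> \<xi>)) (PPi (pren Suc A) (PApp (PVar (Suc 0)) (PVar 0))))"
        by (simp add: red_sort)
    qed
  qed
  show ?thesis
    unfolding pi_term_def
  proof (rule red_PLam)
    show "tred (pi_skel (sort_skel s1) (pi_skel ?k (sort_skel s3))) \<Delta>
       (PPi (PSort s1) (PPi (PPi (PVar 0) (PSort s2)) (PSort s3)))"
      using assms(2) by (intro red_PPi[OF tred_sort]) (auto intro: ty)
  next
    fix \<xi> \<Delta>' N assume "red (sort_skel s1) \<Delta>' (pren \<xi> (PSort s1)) N"
    then show "red (pi_skel ?k (sort_skel s3)) \<Delta>'
       (pinst (N \<cdot> (PVar \<circ> \<xi>)) (PPi (PPi (PVar 0) (PSort s2)) (PSort s3)))
       (pinst (N \<cdot> (PVar \<circ> \<xi>)) (PLam (PPi (PVar 0) (PSort s2))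
         (PPi (PVar (Suc 0)) (PApp (PVar (Suc 0)) (PVar 0)))))"
      using tm[of \<Delta>' N] by simp
  qed
qed

end

section \<open>Validity of framework judgments\<close>

context functional_pts
begin

definition env_ok :: "'s sconst dterm list \<Rightarrow> (nat \<Rightarrow> 's pterm) \<Rightarrow> 's pterm list \<Rightarrow> bool" where
  "env_ok \<Gamma> \<sigma> \<Delta> \<longleftrightarrow> pwf \<Delta> \<and>
     (\<forall>i < length \<Gamma>. red (skel (\<Gamma> ! i)) \<Delta> (pinst \<sigma> (lookup (map inv_tr \<Gamma>) i)) (\<sigma> i))"

lemma env_ok_Cons:
  assumes \<sigma>: "env_ok \<Gamma> \<sigma> \<Delta>" and \<xi>: "ren_ok \<Delta> \<xi> \<Delta>'"
    and N: "red (skel A) \<Delta>' (pren \<xi> (pinst \<sigma> (inv_tr A))) N"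
  shows "env_ok (A # \<Gamma>) (N \<cdot> (pren \<xi> \<circ> \<sigma>)) \<Delta>'"
  unfolding env_ok_def
proof (intro conjI allI impI)
  show "pwf \<Delta>'" using \<xi> by (simp add: ren_ok_def)
  fix i assume i: "i < length (A # \<Gamma>)"
  show "red (skel ((A # \<Gamma>) ! i)) \<Delta>'
    (pinst (N \<cdot> (pren \<xi> \<circ> \<sigma>)) (lookup (map inv_tr (A # \<Gamma>)) i)) ((N \<cdot> (pren \<xi> \<circ> \<sigma>)) i)"
  proof (cases i)
    case 0
    with N show ?thesis by (simp add: pinst_scons_pren_Suc pren_pinst)
  next
    case (Suc j)
    with i \<sigma> have "red (skel (\<Gamma> ! j)) \<Delta> (pinst \<sigma> (lookup (map inv_tr \<Gamma>) j)) (\<sigma> j)"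
      by (simp add: env_ok_def)
    from red_pren[OF this \<xi>] Suc show ?thesis by (simp add: pinst_scons_pren_Suc pren_pinst)
  qed
qed

lemma pinst_scons_pup_ren:
  "pinst (N \<cdot> (PVar \<circ> \<xi>)) (pinst (pup \<sigma>) M) = pinst (N \<cdot> (pren \<xi> \<circ> \<sigma>)) M"
proof -
  have "pinst (PVar \<circ> \<xi>) \<circ> \<sigma> = pren \<xi> \<circ> \<sigma>" by (rule ext) (simp add: pren_eq_pinst)
  then show ?thesis by (simp only: pinst_scons_pup)
qed

definition obj_valid :: "'s sconst dterm list \<Rightarrow> 's sconst dterm \<Rightarrow> 's sconst dterm \<Rightarrow> bool" where
  "obj_valid \<Gamma> M A \<longleftrightarrow> fam A \<and>
     (\<forall>\<sigma> \<Delta>. env_ok \<Gamma> \<sigma> \<Delta> \<longrightarrow> red (skel A) \<Delta> (pinst \<sigma> (inv_tr A)) (pinst \<sigma> (inv_tr M)))"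

definition fam_valid :: "'s sconst dterm list \<Rightarrow> 's sconst dterm \<Rightarrow> 's sconst dterm \<Rightarrow> bool" where
  "fam_valid \<Gamma> M K \<longleftrightarrow> kind K \<and> fam M \<and>
     (\<forall>\<sigma> \<Delta>. env_ok \<Gamma> \<sigma> \<Delta> \<longrightarrow>
        fred (kskel K) (skel M) \<Delta> (pinst \<sigma> (inv_tr K)) (pinst \<sigma> (inv_tr M)))"

text \<open>The three levels of the framework are told apart by the type: kinds are only recognised
  syntactically, while families and objects are interpreted.\<close>

definition valid :: "'s sconst dterm list \<Rightarrow> 's sconst dterm \<Rightarrow> 's sconst dterm \<Rightarrow> bool" where
  "valid \<Gamma> M A \<longleftrightarrow> (A = DSort Kind \<and> kind M) \<or> fam_valid \<Gamma> M A \<or> obj_valid \<Gamma> M A"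

lemma valid_TypeD: "valid \<Gamma> A (DSort Type) \<Longrightarrow> fam_valid \<Gamma> A (DSort Type)"
  by (auto simp: valid_def obj_valid_def)

lemma fam_valid_TypeD:
  "fam_valid \<Gamma> A (DSort Type) \<Longrightarrow> env_ok \<Gamma> \<sigma> \<Delta> \<Longrightarrow> tred (skel A) \<Delta> (pinst \<sigma> (inv_tr A))"
  by (auto simp: fam_valid_def)

lemma valid_KindD: "valid \<Gamma> A (DSort Kind) \<Longrightarrow> kind A"
  by (auto simp: valid_def obj_valid_def fam_valid_def)

lemma valid_var:
  assumes "\<forall>B \<in> set \<Gamma>. fam B" "i < length \<Gamma>"
  shows "obj_valid \<Gamma> (DVar i) ((dlift 0 ^^ Suc i) (\<Gamma> ! i))"
proof -
  have fam: "fam (\<Gamma> ! i)" using assms by simp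
  have inv: "inv_tr ((dlift 0 ^^ Suc i) (\<Gamma> ! i)) = lookup (map inv_tr \<Gamma>) i"
    using assms(2) by (simp only: inv_tr_dlifts lookup_def nth_map)
  show ?thesis
    unfolding obj_valid_def inv skel_dlifts[OF fam] env_ok_def
    using fam_dlifts[OF fam, of "Suc i"] assms(2) by (auto simp del: funpow.simps)
qed

lemma valid_const:
  assumes "sigS Srt Ax Rl c T" shows "valid \<Gamma> (DConst c) T"
  using assms
proof cases
  case (sig_U s)
  then show ?thesis by (simp add: valid_def fam_valid_def env_ok_def tred_sort)
next
  case (sig_Eps s)
  then show ?thesis
    using red_eps_term by (simp add: valid_def fam_valid_def eps_term_def del: fred.simps)
next
  case (sig_Dot s1 s2)
  then have "\<Delta> \<turnstile> PSort s1 : PSort s2" if "pwf \<Delta>" for \<Delta> using that by (blast intro: ptyp_sort)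
  with sig_Dot show ?thesis
    by (auto simp: valid_def obj_valid_def env_ok_def red_sort intro: equivclp_refl)
next
  case (sig_Pi s1 s2 s3)
  \<comment> \<open>The declared type applies \<open>Eps s1\<close> to the bound variable, so its
    inverse image contains an identity redex that is absent from the type in
    \<open>red_pi_term\<close>.\<close>
  have "pconv (PPi (PSort s1) (PPi (PPi (PVar 0) (PSort s2)) (PSort s3)))
    (PPi (PSort s1) (PPi (PPi (PApp (eps_term s1) (PVar 0)) (PSort s2)) (PSort s3)))"
    by (intro pconv_pi equivclp_refl equivclp_sym[OF eps_term_pconv])
  from red_conv[OF red_pi_term[OF sig_Pi(3)] this equivclp_refl]
  have "obj_valid \<Gamma> (DConst c) T" unfolding sig_Pi(1,2)
    by (simp add: obj_valid_def env_ok_def eps_term_def pi_term_def)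
  then show ?thesis by (simp add: valid_def)
qed

lemma valid_pi:
  assumes A: "fam_valid \<Gamma> A (DSort Type)" and B: "valid (A # \<Gamma>) B (DSort s)"
  shows "valid \<Gamma> (DPi A B) (DSort s)"
proof (cases s)
  case Kind
  with A B valid_KindD[of "A # \<Gamma>" B] show ?thesis by (auto simp: valid_def fam_valid_def)
next
  case Type
  with B have B: "fam_valid (A # \<Gamma>) B (DSort Type)" by (blast intro: valid_TypeD)
  have "tred (skel (DPi A B)) \<Delta> (pinst \<sigma> (inv_tr (DPi A B)))" if \<sigma>: "env_ok \<Gamma> \<sigma> \<Delta>" for \<sigma> \<Delta>
    using fam_valid_TypeD[OF A \<sigma>] fam_valid_TypeD[OF B env_ok_Cons[OF \<sigma>]]
    by (simp add: red_PPi pinst_scons_pup_ren)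
  with A B Type show ?thesis by (simp add: valid_def fam_valid_def)
qed

text \<open>The sort of the product decides the level: \<open>Kind\<close> makes the abstraction a
  family, \<open>Type\<close> an object. The premise on \<open>M\<close> waits for
  \<open>fam A\<close> because contexts must consist of families.\<close>

lemma valid_lam:
  assumes pi: "valid \<Gamma> (DPi A B) (DSort s)" and M: "fam A \<Longrightarrow> valid (A # \<Gamma>) M B"
  shows "valid \<Gamma> (DLam A M) (DPi A B)"
proof (cases s)
  case Kind
  with pi have AB: "fam A" "kind B" using valid_KindD by fastforce+
  with M have M: "fam_valid (A # \<Gamma>) M B"
    using fam_not_kind by (auto simp: valid_def obj_valid_def)
  have "fred (skel A # kskel B) (skel M) \<Delta> (PPi (pinst \<sigma> (inv_tr A)) (pinst (pup \<sigma>) (inv_tr B)))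
      (PLam (pinst \<sigma> (inv_tr A)) (pinst (pup \<sigma>) (inv_tr M)))" if \<sigma>: "env_ok \<Gamma> \<sigma> \<Delta>" for \<sigma> \<Delta>
    using M env_ok_Cons[OF \<sigma>]
    by (intro fred_PLam) (auto simp: fam_valid_def pinst_scons_pup_ren)
  then have "fam_valid \<Gamma> (DLam A M) (DPi A B)"
    using AB M by (simp add: fam_valid_def del: fred.simps)
  then show ?thesis by (simp add: valid_def)
next
  case Type
  with pi have pi: "fam_valid \<Gamma> (DPi A B) (DSort Type)" by (blast intro: valid_TypeD)
  then have AB: "fam A" "fam B" by (auto simp: fam_valid_def)
  with M have M: "obj_valid (A # \<Gamma>) M B"
    using fam_not_kind by (auto simp: valid_def fam_valid_def)
  have "red (skel (DPi A B)) \<Delta> (pinst \<sigma> (inv_tr (DPi A B))) (pinst \<sigma> (inv_tr (DLam A M)))"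
    if \<sigma>: "env_ok \<Gamma> \<sigma> \<Delta>" for \<sigma> \<Delta>
    using fam_valid_TypeD[OF pi \<sigma>] M env_ok_Cons[OF \<sigma>]
    by (simp add: red_PLam obj_valid_def pinst_scons_pup_ren)
  with AB show ?thesis by (simp add: valid_def obj_valid_def)
qed

lemma valid_app:
  assumes M: "valid \<Gamma> M (DPi A B)" and N: "valid \<Gamma> N A"
  shows "valid \<Gamma> (DApp M N) (dsubst B 0 N)"
proof -
  have "fam A" using M by (auto simp: valid_def fam_valid_def obj_valid_def)
  with N have N: "red (skel A) \<Delta> (pinst \<sigma> (inv_tr A)) (pinst \<sigma> (inv_tr N))"
    if "env_ok \<Gamma> \<sigma> \<Delta>" for \<sigma> \<Delta>
    using that fam_not_kind by (auto simp: valid_def fam_valid_def obj_valid_def)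
  from M consider "fam_valid \<Gamma> M (DPi A B)" | "obj_valid \<Gamma> M (DPi A B)" by (auto simp: valid_def)
  then show ?thesis
  proof cases
    case 1
    have "fred (kskel B) (skel M) \<Delta> (pinst \<sigma> (psubst (inv_tr B) 0 (inv_tr N)))
        (pinst \<sigma> (PApp (inv_tr M) (inv_tr N)))" if \<sigma>: "env_ok \<Gamma> \<sigma> \<Delta>" for \<sigma> \<Delta>
      using 1 \<sigma> fred_PApp[OF _ N[OF \<sigma>]]
      by (simp add: fam_valid_def env_ok_def pinst_psubst del: fred.simps)
    with 1 have "fam_valid \<Gamma> (DApp M N) (dsubst B 0 N)"
      by (simp add: fam_valid_def inv_tr_dsubst) (simp add: dsubst_0 kind_dinst kskel_dinst)
    then show ?thesis by (simp add: valid_def)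
  next
    case 2
    have "red (skel B) \<Delta> (pinst \<sigma> (psubst (inv_tr B) 0 (inv_tr N)))
        (pinst \<sigma> (PApp (inv_tr M) (inv_tr N)))" if \<sigma>: "env_ok \<Gamma> \<sigma> \<Delta>" for \<sigma> \<Delta>
      using 2 \<sigma> red_PApp[OF _ N[OF \<sigma>]]
      by (simp add: obj_valid_def env_ok_def pinst_psubst)
    with 2 have "obj_valid \<Gamma> (DApp M N) (dsubst B 0 N)"
      by (simp add: obj_valid_def inv_tr_dsubst) (simp add: dsubst_0 fam_dinst skel_dinst)
    then show ?thesis by (simp add: valid_def)
  qed
qed

text \<open>Confluence keeps a conversion from crossing levels, so the skeletons agree and
  reducibility passes through the converted inverse images.\<close>

lemma valid_conv:
  assumes M: "valid \<Gamma> M A" and B: "valid \<Gamma> B (DSort s)" and c: "dconv (rwS Ax Rl) A B"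
  shows "valid \<Gamma> M B"
proof -
  have B: "fam B \<or> kind B"
    using B valid_KindD valid_TypeD by (cases s) (auto simp: fam_valid_def)
  then have "A \<noteq> DSort Kind" using c Kind_not_dconv by blast
  with M consider "fam_valid \<Gamma> M A" | "obj_valid \<Gamma> M A" by (auto simp: valid_def)
  then show ?thesis
  proof cases
    case 1
    then have kA: "kind A" by (simp add: fam_valid_def)
    then have kB: "kind B" using B fam_kind_not_dconv[OF equivclp_sym[OF c]] by blast
    have "fam_valid \<Gamma> M B"
      using 1 kB kskel_dconv[OF c kA kB] inv_tr_dconv[OF c]
      unfolding fam_valid_def by (metis fred_conv pconv_pinst equivclp_refl)
    then show ?thesis by (simp add: valid_def)
  next
    case 2
    then have fA: "fam A" by (simp add: obj_valid_def)
    then have fB: "fam B" using B fam_kind_not_dconv[OF c] by blast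
    have "obj_valid \<Gamma> M B"
      using 2 fB skel_dconv[OF c fA fB] inv_tr_dconv[OF c]
      unfolding obj_valid_def by (metis red_conv pconv_pinst equivclp_refl)
    then show ?thesis by (simp add: valid_def)
  qed
qed

text \<open>The condition on the context excludes type variables. It persists under binders because
  the domain of every product has type \<open>Type\<close>.\<close>

theorem lp_typ_valid:
  assumes "lp_typ (sigS Srt Ax Rl) (rwS Ax Rl) \<Gamma> M A" and "\<forall>B \<in> set \<Gamma>. fam B"
  shows "valid \<Gamma> M A"
  using assms
proof (induction rule: lp_wf_lp_typ.inducts(2)[where ?P1.0 = "\<lambda>_. True", consumes 1,
    case_names wf_nil wf_cons t_var t_const t_sort t_pi t_lam t_app t_conv])
  case (t_var \<Gamma> i)
  then show ?case unfolding valid_def using valid_var by blast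
next
  case (t_const \<Gamma> c T)
  then show ?case by (blast intro: valid_const)
next
  case (t_sort \<Gamma>)
  then show ?case by (simp add: valid_def)
next
  case (t_pi \<Gamma> A B s)
  then have A: "fam_valid \<Gamma> A (DSort Type)" by (blast intro: valid_TypeD)
  then have "fam A" by (simp add: fam_valid_def)
  with t_pi have "valid (A # \<Gamma>) B (DSort s)" by simp
  with A show ?case by (rule valid_pi)
next
  case (t_lam A \<Gamma> M B s)
  show ?case by (rule valid_lam) (use t_lam in auto)
next
  case (t_app \<Gamma> M A B N)
  then show ?case by (blast intro: valid_app)
next
  case (t_conv \<Gamma> M A B s)
  then show ?case by (blast intro: valid_conv)
qed simp_all

end

subsection \<open>Conservativity\<close>

lemma typ_tr_fam: "typ_tr Ax Rl \<Gamma> A A' \<Longrightarrow> fam A'"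
  by (induction rule: trm_tr_typ_tr.inducts(2)[where ?P1.0 = "\<lambda>_ _ _. True"]) simp_all

text \<open>The sort indices chosen by the translation end up only in annotations that beta steps
  discard, so any choice is undone up to conversion.\<close>

lemma tr_inv_tr:
  shows "trm_tr Ax Rl \<Gamma> M M' \<Longrightarrow> pconv (inv_tr M') M"
    and "typ_tr Ax Rl \<Gamma> A A' \<Longrightarrow> pconv (inv_tr A') A"
proof (induction rule: trm_tr_typ_tr.inducts)
  case (tr_pi \<Gamma> A s1 B s2 s3 A1 A2 B')
  have "pconv (inv_tr (DApp (DApp (DConst (PiC s1 s2 s3)) A1) (DLam A2 B')))
      (PPi (inv_tr A1) (PApp (pren Suc (PLam (inv_tr A2) (inv_tr B'))) (PVar 0)))"
    using pi_term_pconv[of s1 s2 "inv_tr A1" "PLam (inv_tr A2) (inv_tr B')"] by simp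
  also have "pconv \<dots> (PPi A B)"
  proof (rule pconv_pi)
    \<comment> \<open>Weakening the abstraction and applying it to the new variable composes to the
      identity substitution, so the redex contracts to the body.\<close>
    have up: "PVar 0 \<cdot> PVar \<circ> ren_up Suc = PVar"
      by (rule ext, rename_tac i, case_tac i) simp_all
    have "pconv (PApp (pren Suc (PLam (inv_tr A2) (inv_tr B'))) (PVar 0)) (inv_tr B')"
      using pconv_beta[of "pren Suc (inv_tr A2)" "pren (ren_up Suc) (inv_tr B')" "PVar 0"]
      by (simp add: psubst_0 pinst_pren up)
    with tr_pi.IH show "pconv (PApp (pren Suc (PLam (inv_tr A2) (inv_tr B'))) (PVar 0)) B"
      by (blast intro: equivclp_trans)
  qed (use tr_pi.IH in blast)
  finally show ?case .
next
  case (ty_other A \<Gamma> s A')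
  have "pconv (inv_tr (DApp (DConst (Eps s)) A')) (inv_tr A')" by (simp add: eps_term_pconv)
  then show ?case by (rule equivclp_trans) fact
qed (simp_all add: pconv_app pconv_lam pconv_pi)

context functional_pts
begin

text \<open>Source typability provides the axiom or the rule that collapses the skeleton; for the
  remaining types, uniqueness of types equates \<open>s\<close> with the index of
  \<open>Eps\<close>.\<close>

lemma typ_tr_skel:
  assumes "typ_tr Ax Rl \<Gamma> A A'" and "\<Gamma> \<turnstile> A : PSort s" shows "skel A' = Small s"
  using assms
proof (induction arbitrary: s rule: trm_tr_typ_tr.inducts(2)[where ?P1.0 = "\<lambda>_ _ _. True", consumes 1,
    case_names tr_sort tr_var tr_app tr_lam tr_pi ty_sort ty_pi ty_other])
  case (ty_sort \<Gamma> t)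
  then obtain t' where "(t, t') \<in> Ax" "t' = s" by (meson typ_sortE pconv_sort_inject)
  then show ?case by (simp add: sort_skel_Ax)
next
  case (ty_pi \<Gamma> A A' B B')
  from ty_pi.prems obtain s1 s2 s3 where "\<Gamma> \<turnstile> A : PSort s1" "A # \<Gamma> \<turnstile> B : PSort s2"
    "(s1, s2, s3) \<in> Rl" "pconv (PSort s3) (PSort s)" by (rule typ_piE)
  with ty_pi.IH pconv_sort_inject show ?case by (metis skel.simps(6) pi_skel_Rl)
next
  case (ty_other A \<Gamma> t A')
  then have "t = s" by (blast intro: pconv_sort_inject typ_unique)
  then show ?case by simp
qed simp_all

text \<open>Every declared type is typable in the source, so its skeleton is \<open>Small\<close>
  and its variable is reducible simply by being typed.\<close>

lemma ctx_tr_env_ok: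
  assumes "ctx_tr Ax Rl \<Gamma> \<Gamma>'" and "pwf \<Gamma>"
  shows "env_ok \<Gamma>' PVar \<Gamma>"
proof -
  have "length \<Gamma>' = length \<Gamma> \<and>
    (\<forall>i < length \<Gamma>. (\<exists>s. skel (\<Gamma>' ! i) = Small s) \<and> pconv (lookup (map inv_tr \<Gamma>') i) (lookup \<Gamma> i))"
    using assms
  proof (induction rule: ctx_tr.induct)
    case (ctx_cons \<Gamma> \<Gamma>' A A')
    from ctx_cons.prems obtain s where "pwf \<Gamma>" "\<Gamma> \<turnstile> A : PSort s" by (blast dest: wf_ConsD)
    with ctx_cons have IH: "length \<Gamma>' = length \<Gamma> \<and> (\<forall>i < length \<Gamma>.
        (\<exists>s. skel (\<Gamma>' ! i) = Small s) \<and> pconv (lookup (map inv_tr \<Gamma>') i) (lookup \<Gamma> i))"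
      and A': "skel A' = Small s" "pconv (inv_tr A') A"
      by (auto intro: typ_tr_skel tr_inv_tr)
    have "(\<exists>s. skel ((A' # \<Gamma>') ! i) = Small s) \<and>
        pconv (lookup (map inv_tr (A' # \<Gamma>')) i) (lookup (A # \<Gamma>) i)" if "i < length (A # \<Gamma>)" for i
      using that IH A' by (cases i) (auto intro: pconv_pren)
    with IH show ?case by simp
  qed simp
  then show ?thesis
    unfolding env_ok_def using assms(2)
    by simp (metis ptyp_var base_red_def equivclp_refl red.simps(1))
qed

lemma ctx_tr_fam: "ctx_tr Ax Rl \<Gamma> \<Gamma>' \<Longrightarrow> \<forall>B \<in> set \<Gamma>'. fam B"
  by (induction rule: ctx_tr.induct) (auto intro: typ_tr_fam)

lemma conservativity:
  assumes "pwf \<Gamma>" and A: "(\<exists>s. \<Gamma> \<turnstile> A : PSort s) \<or> (\<exists>s. A = PSort s)"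
    and "ctx_tr Ax Rl \<Gamma> \<Gamma>'" "typ_tr Ax Rl \<Gamma> A A'"
    and "lp_typ (sigS Srt Ax Rl) (rwS Ax Rl) \<Gamma>' N A'"
  shows "\<exists>M. \<Gamma> \<turnstile> M : A"
proof -
  have "fam A'" using assms(4) by (rule typ_tr_fam)
  then have "obj_valid \<Gamma>' N A'"
    using lp_typ_valid[OF assms(5) ctx_tr_fam[OF assms(3)]] fam_not_kind
    by (auto simp: valid_def fam_valid_def)
  with ctx_tr_env_ok[OF assms(3,1)] have "red (skel A') \<Gamma> (inv_tr A') (inv_tr N)"
    by (auto simp: obj_valid_def dest!: spec[of _ PVar])
  moreover have "pconv (inv_tr A') A" using assms(4) by (rule tr_inv_tr)
  ultimately have red: "red (skel A') \<Gamma> A (inv_tr N)" by (blast intro: red_conv equivclp_refl)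
  from A show ?thesis
  proof (elim disjE exE)
    fix s assume s: "\<Gamma> \<turnstile> A : PSort s"
    with assms(4) red have "base_red \<Gamma> A (inv_tr N)" by (simp add: typ_tr_skel)
    \<comment> \<open>Converting the representative back to \<open>A\<close> requires
      \<open>A\<close> to be typable. A sort may fail this, so \<open>red_sort\<close> replaces the
      conversion rule in the other case.\<close>
    with s show ?thesis unfolding base_red_def by (blast intro: ptyp_conv equivclp_sym)
  next
    fix s assume s: "A = PSort s"
    with assms(4) have "A' = DConst (U s)" by (auto elim: typ_tr.cases)
    with red s show ?thesis by (auto simp: red_sort)
  qed
qed

end

theorem theorem5p24:
  fixes Srt :: "'s set" and Ax :: "('s \<times> 's) set" and Rl :: "('s \<times> 's \<times> 's) set"
    and \<Gamma> :: "'s pterm list" and A :: "'s pterm"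
    and \<Gamma>' :: "'s sconst dterm list" and A' N :: "'s sconst dterm"
  assumes "pts_spec Srt Ax Rl"
    and "functional_spec Ax Rl"
    and "pts_wf Ax Rl \<Gamma>"
    and "pts_is_type Srt Ax Rl \<Gamma> A"
    and "ctx_tr Ax Rl \<Gamma> \<Gamma>'"
    and "typ_tr Ax Rl \<Gamma> A A'"
    and "lp_typ (sigS Srt Ax Rl) (rwS Ax Rl) \<Gamma>' N A'"
  shows "\<exists>M. pts_typ Ax Rl \<Gamma> M A"
proof -
  interpret functional_pts Ax Rl by unfold_locales (rule assms(2))
  show ?thesis
    using assms(3,4,5,6,7) conservativity unfolding pts_is_type_def by blast
qed

end
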